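(* Let $\omega$ be a modulus of continuity such that $\limsup_{\delta\to+0}\omega(\delta)/\sqrt{\delta}=\infty$. Then there exists a complex-valued function $f\in\mathrm{Lip}_\omega(\mathbb T)$ such that $f\circ h\notin W_2^{1/2}(\mathbb T)$ for every homeomorphism $h$ of the circle $\mathbb T$ onto itself. In particular, if $0<\alpha<1/2$, then there exists a complex-valued function $f\in\mathrm{Lip}_\alpha(\mathbb T)$ such that $f\circ h\notin W_2^{1/2}(\mathbb T)$ for every homeomorphism $h$ of $\mathbb T$ onto itself.
   Context: $\mathbb T=\mathbb R/2\pi\mathbb Z$ is the circle. A modulus of continuity is a nondecreasing continuous function $\omega$ on $[0,+\infty)$ such that $\omega(0)=0$ and $\omega(x+y)\le\omega(x)+\omega(y)$ for all $x,y\ge 0$. For a function $f$ on $\mathbb T$ put $\omega(f,\delta)=\sup_{|t_1-t_2|\le\delta}|f(t_1)-f(t_2)|$, $\delta\ge 0$. $\mathrm{Lip}_\omega(\mathbb T)$ is the class of all complex-valued functions $f$ on $\mathbb T$ with $\omega(f,\delta)=O(\omega(\delta))$ as $\delta\to+0$. For $0<\alpha\le 1$, $\mathrm{Lip}_\alpha(\mathbb T)$ denotes $\mathrm{Lip}_\omega(\mathbb T)$ with $\omega(\delta)=\delta^\alpha$. For an integrable function $f$ on $\mathbb T$ with Fourier series $f(t)\sim\sum_{k\in\mathbb Z}\widehat f(k)e^{ikt}$, where $\widehat f(k)=\frac1{2\pi}\int_0^{2\pi}f(t)e^{-ikt}\,dt$, we say that $f\in W_2^{1/2}(\mathbb T)$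 if $\sum_{k\in\mathbb Z}|\widehat f(k)|^2|k|<\infty$. *)

theory Defs
  imports "HOL-Analysis.Analysis"
begin

text \<open>
  The circle \<open>\<real> / 2\<pi>\<int>\<close> is identified with the unit circle in the complex plane via
  \<open>t \<mapsto> cis t\<close>. A function on the circle is a function of type \<^typ>\<open>complex \<Rightarrow> complex\<close>, of which
  only the values on \<open>circle\<close> matter.
\<close>

abbreviation circle :: "complex set" where
  "circle \<equiv> sphere 0 1"

definition modulus_of_continuity :: "(real \<Rightarrow> real) \<Rightarrow> bool" where
  "modulus_of_continuity \<omega> \<longleftrightarrow>
     mono_on {0..} \<omega> \<and> continuous_on {0..} \<omega> \<and> \<omega> 0 = 0 \<and>
     (\<forall>x\<ge>0. \<forall>y\<ge>0. \<omega> (x + y) \<le> \<omega> x + \<omega> y)"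

text \<open>
  The supremum is taken in the extended reals, since it is infinite for unbounded functions.
\<close>

definition modcont :: "(complex \<Rightarrow> complex) \<Rightarrow> real \<Rightarrow> ereal" where
  "modcont f \<delta> =
     (SUP (t1, t2) \<in> {(t1, t2). \<bar>t1 - t2\<bar> \<le> \<delta>}. ereal (cmod (f (cis t1) - f (cis t2))))"

text \<open>
  The condition is \<open>modcont f \<delta> = O(\<omega> \<delta>)\<close> as \<open>\<delta> \<rightarrow> +0\<close>, written out because the Landau symbols
  of the library do not cover functions with values in \<^typ>\<open>ereal\<close>.
\<close>

definition Lip :: "(real \<Rightarrow> real) \<Rightarrow> (complex \<Rightarrow> complex) set" where
  "Lip \<omega> = {f. \<exists>C>0. \<forall>\<^sub>F \<delta> in at_right 0. modcont f \<delta> \<le> ereal (C * \<bar>\<omega> \<delta>\<bar>)}"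

definition fourier_coeff :: "(complex \<Rightarrow> complex) \<Rightarrow> int \<Rightarrow> complex" where
  "fourier_coeff f k =
     1 / (2 * pi) * (LINT t:{0..2 * pi}|lebesgue. f (cis t) * exp (- (\<i> * of_int k * of_real t)))"

definition W_half :: "(complex \<Rightarrow> complex) set" where
  "W_half = {f. set_integrable lebesgue {0..2 * pi} (\<lambda>t. f (cis t)) \<and>
                (\<lambda>k::int. (cmod (fourier_coeff f k))\<^sup>2 * real_of_int \<bar>k\<bar>) summable_on UNIV}"

end

theory Submission
  imports Defs
begin

text \<open>
  Write \<open>E(F) = \<Sum> \<bar>k\<bar> \<bar>F^(k)\<bar>\<^sup>2\<close> for the quadratic form that decides membership in the Sobolev space. Two facts
  about \<open>E\<close> drive the proof.

  It dominates the signed area swept by a closed curve: \<open>A \<le> 2 \<pi> E(F)\<close>, where \<open>A\<close> is the integral of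
  \<open>Im (cnj F dF)\<close>, twice the usual signed area. Unlike \<open>E\<close>, the area does not change, up to sign, when the curve is reparametrised by a
  homeomorphism (\<open>swept_area_le_sobolev_sum\<close>). And \<open>E\<close> behaves well under maps of the target: if \<open>P\<close> is
  \<open>L\<close>-Lipschitz, then \<open>E(P \<circ> F) \<le> L\<^sup>2 E(F)\<close> (\<open>sobolev_sum_Lipschitz\<close>).
  So a curve of class \<open>Lip \<omega>\<close> whose images under uniformly Lipschitz maps sweep arbitrarily large areas
  stays outside the Sobolev space after every change of variable.

  Such a curve consists of bumps on disjoint arcs of lengths decreasing like \<open>2\<^sup>-\<^sup>n\<close>. On the \<open>n\<close>-th arc the
  modulus rises from \<open>0\<close> to \<open>r\<^sub>n = \<omega>(h\<^sub>n)\<close>, the point turns around the circle of radius \<open>r\<^sub>n\<close> at angular speed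
  \<open>1 / h\<^sub>n\<close>, and the modulus returns to \<open>0\<close>. The choice of radius and speed is compatible with \<open>\<omega>\<close> up to a
  constant, and the area swept is about \<open>2\<^sup>-\<^sup>n \<omega>(h\<^sub>n)\<^sup>2 / h\<^sub>n\<close>, which is as large as desired because
  \<open>\<omega>(h) / sqrt h\<close> is unbounded near \<open>0\<close>. The total area is infinite, so it has to be measured in
  pieces: the difference of the projections onto the discs of radii \<open>r\<^sub>n\<close> and \<open>r\<^sub>n / 2\<close> is \<open>2\<close>-Lipschitz and
  kills all bumps after the \<open>n\<close>-th, since \<open>r\<^sub>n\<close> decreases at least like \<open>2\<^sup>-\<^sup>n\<close>. The earlier bumps survive, but
  all bumps rotate in the same direction and their areas add up (\<open>swept_area_shell\<close>).
\<close>

section \<open>Fourier coefficients and the Fejer energy\<close>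

text \<open>
  Coefficients are taken for functions on the line, so that reparametrised and translated curves can be
  written directly in terms of the angle.
\<close>

definition coef :: "(real \<Rightarrow> complex) \<Rightarrow> int \<Rightarrow> complex" where
  "coef F k = integral {0..2*pi} (\<lambda>t. F t * cis (- (of_int k * t))) / (2 * pi)"

definition mean_sq :: "(real \<Rightarrow> complex) \<Rightarrow> real" where
  "mean_sq F = integral {0..2*pi} (\<lambda>t. (cmod (F t))\<^sup>2) / (2 * pi)"

lemma fourier_coeff_eq_coef:
  assumes "continuous_on UNIV (\<lambda>t. f (cis t))"
  shows "fourier_coeff f k = coef (\<lambda>t. f (cis t)) k"
proof -
  define g where "g = (\<lambda>t. f (cis t) * exp (- (\<i> * of_int k * of_real t)))"
  have g: "g = (\<lambda>t. f (cis t) * cis (- (of_int k * t)))"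
    by (simp add: g_def cis_conv_exp mult.assoc)
  have "continuous_on {0..2*pi} g"
    unfolding g by (intro continuous_intros continuous_on_subset[OF assms]) auto
  then have "set_integrable lborel {0..2*pi} g"
    by (rule borel_integrable_atLeastAtMost')
  then have "set_integrable lebesgue {0..2*pi} g"
    unfolding set_integrable_def by (subst integrable_completion) auto
  then have "(LINT t:{0..2*pi}|lebesgue. g t) = integral {0..2*pi} g"
    by (rule set_lebesgue_integral_eq_integral)
  then show ?thesis
    by (simp add: fourier_coeff_def coef_def g_def[symmetric] g)
qed

lemma integral_of_real_complex:
  fixes u :: "'a::euclidean_space \<Rightarrow> real"
  assumes "u integrable_on S"
  shows "integral S (\<lambda>x. complex_of_real (u x)) = complex_of_real (integral S u)"
  using has_integral_of_real[OF integrable_integral[OF assms]] by (rule integral_unique)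

lemma integral_cis_int:
  "integral {0..2*pi} (\<lambda>t. cis (of_int m * t)) = (if m = 0 then 2 * pi else 0)"
proof (cases "m = 0")
  case False
  have "((\<lambda>t. cis (of_int m * t)) has_integral
      cis (of_int m * (2*pi)) / (\<i> * of_int m) - cis (of_int m * 0) / (\<i> * of_int m)) {0..2*pi}"
  proof (rule fundamental_theorem_of_calculus)
    fix t :: real
    have "((\<lambda>z. exp (\<i> * of_int m * z) / (\<i> * of_int m)) has_field_derivative exp (\<i> * of_int m * of_real t))
        (at (of_real t))"
      using False by (auto intro!: derivative_eq_intros)
    from has_vector_derivative_real_field[OF this]
    show "((\<lambda>t. cis (of_int m * t) / (\<i> * of_int m)) has_vector_derivative cis (of_int m * t))
        (at t within {0..2*pi})"
      by (simp add: cis_conv_exp mult.assoc)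
  qed auto
  moreover have "cis (of_int m * (2*pi)) = 1"
    using cis_multiple_2pi[of "of_int m"] by (simp add: mult_ac)
  ultimately show ?thesis using False by (simp add: integral_unique)
qed (auto simp: scaleR_conv_of_real)

lemma integral_tensor:
  fixes u v :: "real \<Rightarrow> complex"
  assumes "continuous_on UNIV u" "continuous_on UNIV v"
  shows "integral (cbox (0,0) (2*pi,2*pi)) (\<lambda>p. u (fst p) * v (snd p)) =
         integral {0..2*pi} u * integral {0..2*pi} v"
proof -
  have "continuous_on (cbox (0,0) (2*pi,2*pi)) (\<lambda>p. u (fst p) * v (snd p))"
    by (intro continuous_intros continuous_on_compose2[OF assms(1)] continuous_on_compose2[OF assms(2)]) auto
  from integral_prod_continuous[OF this] show ?thesis
    by (simp add: cbox_interval)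
qed

lemma fejer_term:
  fixes F :: "real \<Rightarrow> complex" and m :: int
  assumes F: "continuous_on UNIV F"
  shows "integral (cbox (0,0) (2*pi,2*pi))
      (\<lambda>p. (F (fst p) - F (snd p)) * cnj (F (fst p) - F (snd p)) *
           (cis (of_int m * fst p) * cis (- (of_int m * snd p)))) =
    of_real ((if m = 0 then 8 * pi\<^sup>2 * mean_sq F else 0)
       - 4 * pi\<^sup>2 * ((cmod (coef F m))\<^sup>2 + (cmod (coef F (- m)))\<^sup>2))"
proof -
  let ?T = "cbox (0::real,0::real) (2*pi,2*pi)"
  let ?I = "integral {0..2*pi}"
  let ?e = "\<lambda>t::real. cis (of_int m * t)" and ?d = "\<lambda>t::real. cis (- (of_int m * t))"
  have nsq: "?I (\<lambda>t. F t * cnj (F t)) = of_real (2 * pi * mean_sq F)"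
  proof -
    have "(\<lambda>t. (cmod (F t))\<^sup>2) integrable_on {0..2*pi}"
      by (intro integrable_continuous_interval continuous_intros continuous_on_subset[OF F]) auto
    then show ?thesis
      unfolding mean_sq_def complex_norm_square[symmetric]
      by (subst integral_of_real_complex) auto
  qed
  have ie: "?I ?e = (if m = 0 then 2*pi else 0)" by (rule integral_cis_int)
  have id: "?I ?d = (if m = 0 then 2*pi else 0)" using integral_cis_int[of "-m"] by simp
  have c1: "?I (\<lambda>t. F t * ?d t) = 2 * pi * coef F m" by (simp add: coef_def)
  have c2: "?I (\<lambda>t. F t * ?e t) = 2 * pi * coef F (-m)" by (simp add: coef_def)
  have c3: "?I (\<lambda>t. cnj (F t) * ?e t) = 2 * pi * cnj (coef F m)"
    using arg_cong[OF c1, of cnj] unfolding integral_cnj by (simp add: cis_cnj)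
  have c4: "?I (\<lambda>t. cnj (F t) * ?d t) = 2 * pi * cnj (coef F (-m))"
    using arg_cong[OF c2, of cnj] unfolding integral_cnj by (simp add: cis_cnj)
  let ?A = "\<lambda>p. (F (fst p) * cnj (F (fst p)) * ?e (fst p)) * ?d (snd p)"
  let ?B = "\<lambda>p. ?e (fst p) * (F (snd p) * cnj (F (snd p)) * ?d (snd p))"
  let ?C = "\<lambda>p. (F (fst p) * ?e (fst p)) * (cnj (F (snd p)) * ?d (snd p))"
  let ?D = "\<lambda>p. (cnj (F (fst p)) * ?e (fst p)) * (F (snd p) * ?d (snd p))"
  have A: "integral ?T ?A = ?I (\<lambda>t. F t * cnj (F t) * ?e t) * ?I ?d"
    by (rule integral_tensor) (intro continuous_intros F)+
  have B: "integral ?T ?B = ?I ?e * ?I (\<lambda>t. F t * cnj (F t) * ?d t)"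
    by (rule integral_tensor) (intro continuous_intros F)+
  have C: "integral ?T ?C = ?I (\<lambda>t. F t * ?e t) * ?I (\<lambda>t. cnj (F t) * ?d t)"
    by (rule integral_tensor) (intro continuous_intros F)+
  have D: "integral ?T ?D = ?I (\<lambda>t. cnj (F t) * ?e t) * ?I (\<lambda>t. F t * ?d t)"
    by (rule integral_tensor) (intro continuous_intros F)+
  have ci: "u integrable_on ?T" if "continuous_on UNIV u" for u :: "real \<times> real \<Rightarrow> complex"
    using integrable_continuous[OF continuous_on_subset[OF that]] by auto
  note cI = continuous_intros continuous_on_compose2[OF F]
  have iA: "?A integrable_on ?T" by (rule ci) (intro cI; auto)
  have iB: "?B integrable_on ?T" by (rule ci) (intro cI; auto)
  have iC: "?C integrable_on ?T" by (rule ci) (intro cI; auto)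
  have iD: "?D integrable_on ?T" by (rule ci) (intro cI; auto)
  have "integral ?T (\<lambda>p. (F (fst p) - F (snd p)) * cnj (F (fst p) - F (snd p)) * (?e (fst p) * ?d (snd p)))
     = integral ?T (\<lambda>p. (?A p + ?B p) - (?C p + ?D p))"
    by (simp add: algebra_simps)
  also have "\<dots> = (integral ?T ?A + integral ?T ?B) - (integral ?T ?C + integral ?T ?D)"
    by (simp add: integral_diff integral_add integrable_add iA iB iC iD)
  also have "\<dots> = of_real ((if m = 0 then 8 * pi\<^sup>2 * mean_sq F else 0)
       - 4 * pi\<^sup>2 * ((cmod (coef F m))\<^sup>2 + (cmod (coef F (- m)))\<^sup>2))"
    unfolding A B C D c1 c2 c3 c4 ie id
    unfolding of_real_diff of_real_mult of_real_add complex_norm_square nsq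
    by (cases "m = 0") (simp_all add: nsq, simp_all add: power2_eq_square algebra_simps)
  finally show ?thesis .
qed

text \<open>
  This is \<open>n + 1\<close> times the Fejer kernel in its usual normalisation.
\<close>

definition fejer_kernel :: "nat \<Rightarrow> real \<Rightarrow> real" where
  "fejer_kernel n x = (cmod (\<Sum>j\<le>n. cis (real j * x)))\<^sup>2"

lemma continuous_on_fejer_kernel [continuous_intros]:
  "continuous_on S u \<Longrightarrow> continuous_on S (\<lambda>x. fejer_kernel n (u x))"
  unfolding fejer_kernel_def by (intro continuous_intros)

text \<open>
  The kernel is both nonnegative and a trigonometric polynomial. Nonnegativity makes the energies
  below monotone in the integrand; the expansion used here makes them computable.
\<close>

lemma fejer_kernel_integral:
  fixes w :: "real \<times> real \<Rightarrow> real"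
  assumes w: "continuous_on UNIV w"
  shows "of_real (integral (cbox (0,0) (2*pi,2*pi)) (\<lambda>p. w p * fejer_kernel n (fst p - snd p))) =
    (\<Sum>j\<le>n. \<Sum>l\<le>n. integral (cbox (0,0) (2*pi,2*pi))
       (\<lambda>p. of_real (w p) * (cis (of_int (int j - int l) * fst p) * cis (- (of_int (int j - int l) * snd p)))))"
proof -
  let ?T = "cbox (0::real,0::real) (2*pi,2*pi)"
  let ?R = "\<lambda>p. w p * fejer_kernel n (fst p - snd p)"
  let ?t = "\<lambda>m::int. \<lambda>p. complex_of_real (w p) * (cis (of_int m * fst p) * cis (- (of_int m * snd p)))"
  have ci: "u integrable_on ?T" if "continuous_on UNIV u" for u :: "real \<times> real \<Rightarrow> 'b::banach"
    using integrable_continuous[OF continuous_on_subset[OF that]] by auto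
  have it: "?t m integrable_on ?T" for m by (rule ci) (intro continuous_intros w)
  have iR: "?R integrable_on ?T" by (rule ci) (intro continuous_intros w)
  have pt: "complex_of_real (?R p) = (\<Sum>j\<le>n. \<Sum>l\<le>n. ?t (int j - int l) p)" for p
  proof -
    have e: "cis (real j * (fst p - snd p)) * cnj (cis (real l * (fst p - snd p))) =
        cis (of_int (int j - int l) * fst p) * cis (- (of_int (int j - int l) * snd p))" for j l
      by (simp add: cis_cnj cis_mult algebra_simps)
    show ?thesis
      unfolding of_real_mult fejer_kernel_def complex_norm_square cnj_sum sum_product
      by (simp only: sum_distrib_left e)
  qed
  have "complex_of_real (integral ?T ?R) = integral ?T (\<lambda>p. complex_of_real (?R p))"
    by (rule integral_of_real_complex[OF iR, symmetric])
  also have "\<dots> = integral ?T (\<lambda>p. \<Sum>j\<le>n. \<Sum>l\<le>n. ?t (int j - int l) p)"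
    by (simp only: pt)
  also have "\<dots> = (\<Sum>j\<le>n. integral ?T (\<lambda>p. \<Sum>l\<le>n. ?t (int j - int l) p))"
    by (rule integral_sum[OF finite_atMost]) (intro integrable_sum finite_atMost it)
  also have "\<dots> = (\<Sum>j\<le>n. \<Sum>l\<le>n. integral ?T (?t (int j - int l)))"
    by (intro sum.cong refl integral_sum finite_atMost it)
  finally show ?thesis .
qed

lemma integral_fejer_kernel:
  "integral (cbox (0,0) (2*pi,2*pi)) (\<lambda>p. fejer_kernel n (fst p - snd p)) = 4 * pi\<^sup>2 * (real n + 1)"
proof -
  have "integral (cbox (0,0) (2*pi,2*pi)) (\<lambda>p. cis (of_int m * fst p) * cis (- (of_int m * snd p)))
     = (if m = 0 then 4 * pi\<^sup>2 else 0)" for m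
  proof -
    have "continuous_on UNIV (\<lambda>t. cis (of_int m * t))" "continuous_on UNIV (\<lambda>t. cis (- (of_int m * t)))"
      by (intro continuous_intros)+
    from integral_tensor[OF this] show ?thesis
      using integral_cis_int[of m] integral_cis_int[of "-m"] by (auto simp: power2_eq_square)
  qed
  then have "complex_of_real (integral (cbox (0,0) (2*pi,2*pi)) (\<lambda>p. 1 * fejer_kernel n (fst p - snd p))) =
      (\<Sum>j\<le>n. \<Sum>l\<le>n. of_real (if j = l then 4 * pi\<^sup>2 else 0))"
    by (subst fejer_kernel_integral) (simp_all del: of_int_diff of_real_mult of_real_power)
  also have "\<dots> = of_real (\<Sum>j\<le>n. \<Sum>l\<le>n. if j = l then 4 * pi\<^sup>2 else 0)"
    by (simp only: of_real_sum)
  also have "(\<Sum>j\<le>n. \<Sum>l\<le>n. if j = l then 4 * pi\<^sup>2 else 0) = (\<Sum>j\<le>n. 4 * pi\<^sup>2)"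
    by (intro sum.cong refl) simp
  also have "\<dots> = 4 * pi\<^sup>2 * (real n + 1)" by (simp add: algebra_simps)
  finally show ?thesis by (simp only: of_real_eq_iff mult_1)
qed

text \<open>
  A discrete substitute for Douglas' double integral of \<open>\<bar>F t - F s\<bar>\<^sup>2 / sin\<^sup>2 ((t - s) / 2)\<close>: the kernel
  multiplies this singular weight by \<open>sin\<^sup>2 ((n + 1) (t - s) / 2)\<close>, so that only integrals of continuous
  functions occur. The factor is normalised for the evaluation in \<open>fejer_energy_eq\<close>.
\<close>

definition fejer_energy :: "nat \<Rightarrow> (real \<Rightarrow> complex) \<Rightarrow> real" where
  "fejer_energy n F = integral (cbox (0,0) (2*pi,2*pi))
     (\<lambda>p. (cmod (F (fst p) - F (snd p)))\<^sup>2 * fejer_kernel n (fst p - snd p)) / (8 * pi\<^sup>2)"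

definition power_sum :: "(real \<Rightarrow> complex) \<Rightarrow> nat \<Rightarrow> real" where
  "power_sum F N = (\<Sum>k\<in>{- int N..int N}. (cmod (coef F k))\<^sup>2)"

lemma sum_symmetric_Suc:
  fixes \<phi> :: "int \<Rightarrow> real"
  shows "(\<Sum>k\<in>{- int (Suc N)..int (Suc N)}. \<phi> k) =
     (\<Sum>k\<in>{- int N..int N}. \<phi> k) + (\<phi> (int (Suc N)) + \<phi> (- int (Suc N)))"
proof -
  have "{- int (Suc N)..int (Suc N)} = insert (int (Suc N)) (insert (- int (Suc N)) {- int N..int N})"
    by auto
  then show ?thesis by (simp add: add_ac)
qed

lemma sum_symmetric_split:
  fixes \<phi> :: "int \<Rightarrow> real"
  shows "(\<Sum>k\<in>{- int N..int N}. \<phi> k) = \<phi> 0 + (\<Sum>j<N. \<phi> (int (Suc j)) + \<phi> (- int (Suc j)))"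
proof (induction N)
  case (Suc N)
  then show ?case unfolding sum_symmetric_Suc by simp
qed simp

text \<open>
  Adding row and column \<open>n + 1\<close> to the square adds each difference of modulus at most \<open>n + 1\<close> exactly once.
\<close>

lemma sum_diagonals_cesaro:
  fixes \<phi> :: "int \<Rightarrow> real"
  shows "(\<Sum>j\<le>n. \<Sum>l\<le>n. \<phi> (int j - int l)) = (\<Sum>N\<le>n. \<Sum>k\<in>{- int N..int N}. \<phi> k)"
proof (induction n)
  case (Suc n)
  have r: "(\<Sum>l\<le>n. \<phi> (int (Suc n) - int l)) = (\<Sum>j\<le>n. \<phi> (int (Suc j)))"
    by (rule sum.reindex_bij_witness[of _ "\<lambda>l. n - l" "\<lambda>l. n - l"]) (auto simp: intro!: arg_cong[of _ _ \<phi>])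
  have q: "(\<Sum>l\<le>n. \<phi> (int l - int (Suc n))) = (\<Sum>j\<le>n. \<phi> (- int (Suc j)))"
    by (rule sum.reindex_bij_witness[of _ "\<lambda>l. n - l" "\<lambda>l. n - l"]) (auto simp: intro!: arg_cong[of _ _ \<phi>])
  have "(\<Sum>j\<le>Suc n. \<Sum>l\<le>Suc n. \<phi> (int j - int l)) =
     (\<Sum>j\<le>n. \<Sum>l\<le>n. \<phi> (int j - int l)) + (\<Sum>l\<le>n. \<phi> (int l - int (Suc n))) +
     (\<Sum>l\<le>n. \<phi> (int (Suc n) - int l)) + \<phi> 0"
    by (simp add: sum.distrib)
  then show ?case
    unfolding r q Suc.IH using sum_symmetric_split[where N="Suc n" and \<phi>=\<phi>]
    by (simp add: sum.distrib lessThan_Suc_atMost del: of_nat_Suc)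
qed simp

text \<open>
  Expanding the square and integrating term by term gives a sum over pairs of frequencies, which
  \<open>sum_diagonals_cesaro\<close> turns into a sum of the tails in Bessel's inequality.
\<close>

lemma fejer_energy_eq:
  assumes F: "continuous_on UNIV F"
  shows "fejer_energy n F = (\<Sum>N\<le>n. mean_sq F - power_sum F N)"
proof -
  let ?T = "cbox (0::real,0::real) (2*pi,2*pi)"
  let ?c = "\<lambda>m. (cmod (coef F m))\<^sup>2"
  let ?v = "\<lambda>m::int. ((if m = 0 then 8 * pi\<^sup>2 * mean_sq F else 0) - 4 * pi\<^sup>2 * (?c m + ?c (- m)))"
  have cw: "continuous_on UNIV (\<lambda>p. (cmod (F (fst p) - F (snd p)))\<^sup>2)"
    by (intro continuous_intros continuous_on_compose2[OF F]; auto)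
  have "8 * pi\<^sup>2 * fejer_energy n F = integral ?T
     (\<lambda>p. (cmod (F (fst p) - F (snd p)))\<^sup>2 * fejer_kernel n (fst p - snd p))"
    by (simp add: fejer_energy_def)
  then have "complex_of_real (8 * pi\<^sup>2 * fejer_energy n F) = (\<Sum>j\<le>n. \<Sum>l\<le>n. of_real (?v (int j - int l)))"
    using fejer_kernel_integral[OF cw, of n] unfolding complex_norm_square fejer_term[OF F] by (simp only:)
  then have 1: "8 * pi\<^sup>2 * fejer_energy n F = (\<Sum>j\<le>n. \<Sum>l\<le>n. ?v (int j - int l))"
    unfolding of_real_sum[symmetric] by (simp only: of_real_eq_iff)
  have row: "(\<Sum>l\<le>n. ?v (int j - int l)) = 8 * pi\<^sup>2 * mean_sq F
     - 4 * pi\<^sup>2 * ((\<Sum>l\<le>n. ?c (int j - int l)) + (\<Sum>l\<le>n. ?c (int l - int j)))" if "j \<le> n" for j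
    using that by (simp add: sum_subtractf sum.distrib flip: sum_distrib_left)
  have "(\<Sum>j\<le>n. \<Sum>l\<le>n. ?v (int j - int l)) =
     (\<Sum>j\<le>n. 8 * pi\<^sup>2 * mean_sq F)
      - 4 * pi\<^sup>2 * ((\<Sum>j\<le>n. \<Sum>l\<le>n. ?c (int j - int l)) + (\<Sum>j\<le>n. \<Sum>l\<le>n. ?c (int l - int j)))"
    by (simp add: row sum_subtractf sum.distrib flip: sum_distrib_left)
  also have "(\<Sum>j\<le>n. \<Sum>l\<le>n. ?c (int l - int j)) = (\<Sum>j\<le>n. \<Sum>l\<le>n. ?c (int j - int l))"
    by (rule sum.swap)
  also have "(\<Sum>j\<le>n. \<Sum>l\<le>n. ?c (int j - int l)) = (\<Sum>N\<le>n. power_sum F N)"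
    unfolding power_sum_def by (rule sum_diagonals_cesaro)
  finally have "8 * pi\<^sup>2 * fejer_energy n F =
      (\<Sum>j\<le>n. 8 * pi\<^sup>2 * mean_sq F) - 4 * pi\<^sup>2 * ((\<Sum>N\<le>n. power_sum F N) + (\<Sum>N\<le>n. power_sum F N))"
    by (simp only: 1)
  also have "\<dots> = 8 * pi\<^sup>2 * (\<Sum>N\<le>n. mean_sq F - power_sum F N)"
    by (simp add: sum_subtractf right_diff_distrib)
  finally show ?thesis by simp
qed

section \<open>Parseval's identity\<close>

lemma power_sum_mono: "N \<le> M \<Longrightarrow> power_sum F N \<le> power_sum F M"
  unfolding power_sum_def by (rule sum_mono2) auto

lemma fejer_energy_nonneg:
  assumes F: "continuous_on UNIV F"
  shows "0 \<le> fejer_energy n F"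
proof -
  have "continuous_on UNIV (\<lambda>p. (cmod (F (fst p) - F (snd p)))\<^sup>2 * fejer_kernel n (fst p - snd p))"
    by (intro continuous_intros continuous_on_compose2[OF F]; auto)
  then show ?thesis
    unfolding fejer_energy_def
    by (intro divide_nonneg_nonneg integral_nonneg integrable_continuous)
      (auto simp: fejer_kernel_def intro: continuous_on_subset)
qed

text \<open>
  The tails decrease in \<open>N\<close> and their partial sums are energies, hence nonnegative. A negative tail would
  make the partial sums tend to minus infinity.
\<close>

lemma bessel:
  assumes F: "continuous_on UNIV F"
  shows "power_sum F N \<le> mean_sq F"
proof (rule ccontr)
  assume neg: "\<not> power_sum F N \<le> mean_sq F"
  define \<eta> where "\<eta> = power_sum F N - mean_sq F"
  have \<eta>: "\<eta> > 0" using neg by (simp add: \<eta>_def)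
  define B where "B = (\<Sum>M\<le>N. mean_sq F - power_sum F M)"
  have "0 \<le> B - real m * \<eta>" for m
  proof -
    have "0 \<le> fejer_energy (N + m) F" by (rule fejer_energy_nonneg[OF F])
    also have "\<dots> = B + (\<Sum>M\<in>{N<..N+m}. mean_sq F - power_sum F M)"
      unfolding fejer_energy_eq[OF F] B_def
      by (subst sum.union_disjoint[symmetric]) (auto intro!: sum.cong)
    also have "(\<Sum>M\<in>{N<..N+m}. mean_sq F - power_sum F M) \<le> (\<Sum>M\<in>{N<..N+m}. - \<eta>)"
      by (intro sum_mono) (use power_sum_mono[of N _ F] in \<open>auto simp: \<eta>_def\<close>)
    finally show ?thesis by simp
  qed
  moreover obtain m where "B < real m * \<eta>" using reals_Archimedean3[OF \<eta>] by blast
  ultimately show False by (metis diff_ge_0_iff_ge not_le)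
qed

lemma coef_cis: "coef cis k = (if k = 1 then 1 else 0)"
proof -
  have "coef cis k = integral {0..2*pi} (\<lambda>t. cis (of_int (1 - k) * t)) / (2 * pi)"
    unfolding coef_def by (simp add: cis_mult algebra_simps)
  then show ?thesis unfolding integral_cis_int by auto
qed

lemma fejer_energy_cis: "fejer_energy n cis = 1"
proof -
  have "continuous_on UNIV cis" by (intro continuous_intros)
  moreover have "mean_sq cis = 1" by (simp add: mean_sq_def)
  moreover have "power_sum cis N = (if N = 0 then 0 else 1)" for N
    by (auto simp: power_sum_def coef_cis if_distrib[of cmod] if_distrib[of "\<lambda>x. x^2"] cong: if_cong)
  ultimately show ?thesis
    by (simp add: fejer_energy_eq if_distrib[of "\<lambda>x. 1 - x"] cong: if_cong)
qed

text \<open>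
  This single comparison serves twice: with \<open>\<epsilon> > 0\<close> and \<open>F\<close> the identity of the circle it gives Parseval's
  identity, with \<open>\<epsilon> = 0\<close> it gives the behaviour of the energies under Lipschitz maps.
\<close>

lemma fejer_energy_bound:
  assumes F: "continuous_on UNIV F" and G: "continuous_on UNIV G" and "0 \<le> C"
    and le: "\<And>t s. (cmod (G t - G s))\<^sup>2 \<le> \<epsilon> + C * (cmod (F t - F s))\<^sup>2"
  shows "fejer_energy n G \<le> \<epsilon> * (real n + 1) / 2 + C * fejer_energy n F"
proof -
  let ?T = "cbox (0::real,0::real) (2*pi,2*pi)"
  let ?k = "\<lambda>p. fejer_kernel n (fst p - snd p)"
  let ?w = "\<lambda>F p. (cmod (F (fst p) - F (snd p)))\<^sup>2 * ?k p"
  have ci: "u integrable_on ?T" if "continuous_on UNIV u" for u :: "real \<times> real \<Rightarrow> 'b::banach"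
    using integrable_continuous[OF continuous_on_subset[OF that]] by auto
  have iG: "?w G integrable_on ?T" by (rule ci) (intro continuous_intros continuous_on_compose2[OF G]; auto)
  have iF: "?w F integrable_on ?T" by (rule ci) (intro continuous_intros continuous_on_compose2[OF F]; auto)
  have ik: "?k integrable_on ?T" by (rule ci) (intro continuous_intros)
  have "integral ?T (?w G) \<le> integral ?T (\<lambda>p. \<epsilon> * ?k p + C * ?w F p)"
  proof (rule integral_le[OF iG])
    show "(\<lambda>p. \<epsilon> * ?k p + C * ?w F p) integrable_on ?T"
      by (intro integrable_add integrable_on_mult_right ik iF)
    fix p
    have "0 \<le> ?k p" by (simp add: fejer_kernel_def)
    from mult_right_mono[OF le this] show "?w G p \<le> \<epsilon> * ?k p + C * ?w F p"
      by (simp add: algebra_simps)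
  qed
  also have "\<dots> = \<epsilon> * integral ?T ?k + C * integral ?T (?w F)"
    by (simp add: integral_add integrable_on_mult_right ik iF)
  finally show ?thesis
    unfolding integral_fejer_kernel fejer_energy_def by (simp add: field_simps)
qed

lemma korovkin_bound:
  fixes f :: "complex \<Rightarrow> complex"
  assumes f: "continuous_on circle f" and "\<epsilon> > 0"
  obtains C where "C \<ge> 0" "\<And>t s. (cmod (f (cis t) - f (cis s)))\<^sup>2 \<le> \<epsilon> + C * (cmod (cis t - cis s))\<^sup>2"
proof -
  have "uniformly_continuous_on circle f"
    using f by (intro compact_uniformly_continuous) auto
  then obtain \<delta> where \<delta>: "\<delta> > 0" "\<And>z w. z \<in> circle \<Longrightarrow> w \<in> circle \<Longrightarrow> dist z w < \<delta> \<Longrightarrow> dist (f z) (f w) < sqrt \<epsilon>"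
    using \<open>\<epsilon> > 0\<close> unfolding uniformly_continuous_on_def by (metis real_sqrt_gt_zero)
  have "bounded (f ` circle)" using f by (intro compact_imp_bounded compact_continuous_image) auto
  then obtain B where B: "\<And>z. z \<in> circle \<Longrightarrow> cmod (f z) \<le> B" unfolding bounded_iff by blast
  have c: "cis t \<in> circle" for t by simp
  show thesis
  proof (rule that[of "(2 * B)\<^sup>2 / \<delta>\<^sup>2"])
    fix t s
    show "(cmod (f (cis t) - f (cis s)))\<^sup>2 \<le> \<epsilon> + (2 * B)\<^sup>2 / \<delta>\<^sup>2 * (cmod (cis t - cis s))\<^sup>2"
    proof (cases "cmod (cis t - cis s) < \<delta>")
      case True
      then have "cmod (f (cis t) - f (cis s)) < sqrt \<epsilon>" using \<delta>(2)[OF c c] by (simp add: dist_norm)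
      then have "(cmod (f (cis t) - f (cis s)))\<^sup>2 \<le> (sqrt \<epsilon>)\<^sup>2" by (intro power_mono) auto
      then show ?thesis using \<open>\<epsilon> > 0\<close> by (simp add: add_increasing2)
    next
      case False
      have "cmod (f (cis t) - f (cis s)) \<le> 2 * B"
        using norm_triangle_ineq4[of "f (cis t)" "f (cis s)"] B[OF c, of t] B[OF c, of s] by linarith
      then have "(cmod (f (cis t) - f (cis s)))\<^sup>2 \<le> (2 * B)\<^sup>2" by (intro power_mono) auto
      also have "\<dots> \<le> (2 * B)\<^sup>2 / \<delta>\<^sup>2 * (cmod (cis t - cis s))\<^sup>2"
      proof -
        have "\<delta>\<^sup>2 \<le> (cmod (cis t - cis s))\<^sup>2" using False \<delta>(1) by (intro power_mono) auto
        then have "(2 * B)\<^sup>2 * \<delta>\<^sup>2 \<le> (2 * B)\<^sup>2 * (cmod (cis t - cis s))\<^sup>2" by (intro mult_left_mono) auto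
        then show ?thesis using \<delta>(1) by (simp add: field_simps)
      qed
      finally show ?thesis using \<open>\<epsilon> > 0\<close> by simp
    qed
  qed simp
qed

lemma continuous_on_cis_compose:
  "continuous_on circle f \<Longrightarrow> continuous_on UNIV (\<lambda>t. f (cis t))"
  by (erule continuous_on_compose2) (auto intro!: continuous_on_cis continuous_on_id)

text \<open>
  Korovkin's argument: a continuous function is controlled by an arbitrarily small constant plus a multiple
  of the identity map, and the latter has energy \<open>1\<close> for every \<open>n\<close>. So the energies of \<open>F\<close> are \<open>o(n)\<close>; since they
  are sums of \<open>n + 1\<close> decreasing tails, the tails tend to \<open>0\<close>.
\<close>

lemma parseval:
  fixes f :: "complex \<Rightarrow> complex"
  assumes f: "continuous_on circle f"
  shows "power_sum (\<lambda>t. f (cis t)) \<longlonglongrightarrow> mean_sq (\<lambda>t. f (cis t))"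
proof (rule LIMSEQ_I)
  fix r :: real assume r: "r > 0"
  let ?F = "\<lambda>t. f (cis t)"
  note F = continuous_on_cis_compose[OF f]
  obtain C where C: "C \<ge> 0" "\<And>t s. (cmod (?F t - ?F s))\<^sup>2 \<le> r + C * (cmod (cis t - cis s))\<^sup>2"
    using korovkin_bound[OF f r] by blast
  obtain N :: nat where N: "C < real N * (r / 2)" using reals_Archimedean3[of "r/2"] r half_gt_zero by blast
  have "norm (power_sum ?F n - mean_sq ?F) < r" if "n \<ge> N" for n
  proof -
    have "(mean_sq ?F - power_sum ?F n) * (real n + 1) = (\<Sum>M\<le>n. mean_sq ?F - power_sum ?F n)"
      by simp
    also have "\<dots> \<le> fejer_energy n ?F"
      unfolding fejer_energy_eq[OF F] by (intro sum_mono) (auto intro: power_sum_mono)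
    also have "\<dots> \<le> r * (real n + 1) / 2 + C * fejer_energy n cis"
      using C by (intro fejer_energy_bound F) (auto intro!: continuous_intros)
    also have "\<dots> < r * (real n + 1) / 2 + (real n + 1) * (r / 2)"
    proof -
      have "real N * (r / 2) \<le> (real n + 1) * (r / 2)" using that r by (intro mult_right_mono) auto
      then show ?thesis using N unfolding fejer_energy_cis by linarith
    qed
    also have "\<dots> = r * (real n + 1)" by (simp add: field_simps)
    finally have "mean_sq ?F - power_sum ?F n < r" by (rule mult_right_less_imp_less) simp
    with bessel[OF F, of n] show ?thesis by simp
  qed
  then show "\<exists>no. \<forall>n\<ge>no. norm (power_sum ?F n - mean_sq ?F) < r" by blast
qed

section \<open>The Sobolev sum and Lipschitz maps of the target\<close>

definition sobolev_sum :: "(real \<Rightarrow> complex) \<Rightarrow> nat \<Rightarrow> real" where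
  "sobolev_sum F N = (\<Sum>k\<in>{- int N..int N}. real_of_int \<bar>k\<bar> * (cmod (coef F k))\<^sup>2)"

text \<open>
  Summation by parts: frequency \<open>k\<close> is counted once for every \<open>N < \<bar>k\<bar>\<close>. The same tails occur in the Fejer
  energies, which is why the two quantities bound each other below.
\<close>

lemma sobolev_sum_eq: "sobolev_sum F M = (\<Sum>N<M. power_sum F M - power_sum F N)"
proof (induction M)
  case (Suc M)
  have "(\<Sum>N<Suc M. power_sum F (Suc M) - power_sum F N) =
     (\<Sum>N<Suc M. (power_sum F (Suc M) - power_sum F M) + (power_sum F M - power_sum F N))"
    by simp
  also have "\<dots> = real (Suc M) * (power_sum F (Suc M) - power_sum F M) + sobolev_sum F M"
    unfolding sum.distrib by (simp add: Suc.IH)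
  also have "\<dots> = sobolev_sum F (Suc M)"
    unfolding power_sum_def sobolev_sum_def sum_symmetric_Suc by (simp add: algebra_simps)
  finally show ?case by simp
qed (simp add: sobolev_sum_def)

lemma fejer_energy_le:
  assumes f: "continuous_on circle f" and E: "\<And>M. sobolev_sum (\<lambda>t. f (cis t)) M \<le> E"
  shows "fejer_energy n (\<lambda>t. f (cis t)) \<le> E"
proof -
  let ?F = "\<lambda>t. f (cis t)"
  have "(\<lambda>M. \<Sum>N\<le>n. power_sum ?F M - power_sum ?F N) \<longlonglongrightarrow> (\<Sum>N\<le>n. mean_sq ?F - power_sum ?F N)"
    by (intro tendsto_intros parseval[OF f])
  moreover have "\<forall>\<^sub>F M in sequentially. (\<Sum>N\<le>n. power_sum ?F M - power_sum ?F N) \<le> E"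
    using eventually_gt_at_top[of n]
  proof eventually_elim
    case (elim M)
    have "(\<Sum>N\<le>n. power_sum ?F M - power_sum ?F N) \<le> (\<Sum>N<M. power_sum ?F M - power_sum ?F N)"
      using elim by (intro sum_mono2) (auto intro: power_sum_mono)
    then show ?case using E[of M] by (simp add: sobolev_sum_eq)
  qed
  ultimately show ?thesis
    unfolding fejer_energy_eq[OF continuous_on_cis_compose[OF f]]
    by (rule tendsto_upperbound) simp
qed

lemma sobolev_sum_le_fejer_energy:
  assumes F: "continuous_on UNIV F"
  shows "sobolev_sum F M \<le> fejer_energy M F"
proof -
  have "sobolev_sum F M \<le> (\<Sum>N<M. mean_sq F - power_sum F N)"
    unfolding sobolev_sum_eq by (intro sum_mono diff_right_mono bessel F)
  also have "\<dots> \<le> fejer_energy M F"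
    unfolding fejer_energy_eq[OF F] by (intro sum_mono2) (use bessel[OF F] in auto)
  finally show ?thesis .
qed

text \<open>
  The form itself is not visibly monotone in the increments of the function, but it is squeezed between the
  Fejer energies, which are.
\<close>

lemma sobolev_sum_Lipschitz:
  assumes f: "continuous_on circle f" and G: "continuous_on UNIV G"
    and E: "\<And>M. sobolev_sum (\<lambda>t. f (cis t)) M \<le> E"
    and L: "\<And>t s. cmod (G t - G s) \<le> L * cmod (f (cis t) - f (cis s))"
  shows "sobolev_sum G M \<le> L\<^sup>2 * E"
proof -
  note F = continuous_on_cis_compose[OF f]
  have "(cmod (G t - G s))\<^sup>2 \<le> 0 + L\<^sup>2 * (cmod (f (cis t) - f (cis s)))\<^sup>2" for t s
    using power_mono[OF L, of t s 2] by (simp add: power_mult_distrib)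
  from fejer_energy_bound[OF F G _ this, of M]
  have "fejer_energy M G \<le> L\<^sup>2 * fejer_energy M (\<lambda>t. f (cis t))" by simp
  also have "\<dots> \<le> L\<^sup>2 * E" by (intro mult_left_mono fejer_energy_le f E) auto
  finally show ?thesis using sobolev_sum_le_fejer_energy[OF G, of M] by simp
qed

section \<open>Correlations of a loop with its translates\<close>

text \<open>
  Shifting the interval of integration by \<open>s\<close> trades \<open>{0..s}\<close> for \<open>{2*pi..2*pi+s}\<close>, and there the function
  differs by its period increment. For \<open>P = 0\<close> this is the invariance of integrals over a period; for the lift
  of a homeomorphism and for the area along a curve the increment is what the argument is about.
\<close>

lemma integral_shift_quasiperiodic:
  fixes K :: "real \<Rightarrow> 'a::euclidean_space"
  assumes K: "continuous_on UNIV K" and per: "\<And>t. K (t + 2 * pi) = K t + P"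
  shows "integral {0..2*pi} (\<lambda>t. K (t + s) - K t) = s *\<^sub>R P"
proof -
  have pos: "integral {0..2*pi} (\<lambda>t. L (t + s) - L t) = s *\<^sub>R P"
    if "s \<ge> 0" and L: "continuous_on UNIV L" and per: "\<And>t. L (t + 2 * pi) = L t + P"
    for L :: "real \<Rightarrow> 'a" and s :: real
  proof -
    have i: "L integrable_on {a..b}" for a b
      by (intro integrable_continuous_interval continuous_on_subset[OF L]) auto
    have cs: "continuous_on UNIV (\<lambda>t. L (t + c))" for c
      by (intro continuous_on_compose2[OF L] continuous_intros) auto
    have isf: "(\<lambda>t. L (t + c)) integrable_on {a..b}" for a b c
      by (intro integrable_continuous_interval continuous_on_subset[OF cs]) auto
    have sh: "integral {a..b} (\<lambda>t. L (t + c)) = integral {a+c..b+c} L" for a b c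
      using integral_shift_real_ivl[of "a+c" c "b+c" L] by simp
    have "integral {0..s} L + integral {s..2*pi+s} L = integral {0..2*pi+s} L"
      using \<open>s \<ge> 0\<close> by (intro Henstock_Kurzweil_Integration.integral_combine i) auto
    moreover have "integral {0..2*pi} L + integral {2*pi..2*pi+s} L = integral {0..2*pi+s} L"
      using \<open>s \<ge> 0\<close> by (intro Henstock_Kurzweil_Integration.integral_combine i) auto
    moreover have "integral {2*pi..2*pi+s} L = integral {0..s} L + s *\<^sub>R P"
    proof -
      have "integral {2*pi..2*pi+s} L = integral {0..s} (\<lambda>t. L (t + 2*pi))"
        by (subst sh) (simp add: add.commute)
      also have "\<dots> = integral {0..s} L + s *\<^sub>R P"
        unfolding per using \<open>s \<ge> 0\<close> by (subst integral_add[OF i]) auto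
      finally show ?thesis .
    qed
    ultimately have "integral {0..s} L + integral {s..2*pi+s} L =
        integral {0..s} L + (integral {0..2*pi} L + s *\<^sub>R P)"
      by (simp add: add_ac)
    then have "integral {s..2*pi+s} L = integral {0..2*pi} L + s *\<^sub>R P"
      by (rule add_left_imp_eq)
    then show ?thesis
      using integral_diff[OF isf[of s 0 "2*pi"] i[of 0 "2*pi"]] sh[of 0 "2*pi" s] by simp
  qed
  show ?thesis
  proof (cases "s \<ge> 0")
    case True
    then show ?thesis using pos[OF _ K per] by simp
  next
    case False
    have L: "continuous_on UNIV (\<lambda>t. K (t + s))"
      by (intro continuous_on_compose2[OF K] continuous_intros) auto
    have "K (t + 2 * pi + s) = K (t + s) + P" for t using per[of "t + s"] by (simp add: add_ac)
    from pos[of "-s", OF _ L this] False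
    have "integral {0..2*pi} (\<lambda>t. K t - K (t + s)) = - s *\<^sub>R P" by simp
    then have "- integral {0..2*pi} (\<lambda>t. K t - K (t + s)) = s *\<^sub>R P" by simp
    then show ?thesis unfolding integral_neg[symmetric] by simp
  qed
qed

lemma coef_shift:
  assumes f: "continuous_on circle f"
  shows "coef (\<lambda>t. f (cis (t + s))) k = cis (of_int k * s) * coef (\<lambda>t. f (cis t)) k"
proof -
  let ?K = "\<lambda>t. f (cis t) * cis (- (of_int k * t))"
  note F = continuous_on_cis_compose[OF f]
  have K: "continuous_on UNIV ?K" by (intro continuous_intros F)
  have Ks: "continuous_on UNIV (\<lambda>t. ?K (t + s))"
    by (rule continuous_on_compose2[OF K]) (auto intro!: continuous_intros)
  have per: "?K (t + 2 * pi) = ?K t + 0" for t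
  proof -
    have "cis (- (of_int k * (t + 2 * pi))) = cis (- (of_int k * t)) * cis (2 * pi * of_int (- k))"
      by (simp add: cis_mult algebra_simps)
    then show ?thesis using cis_multiple_2pi[of "of_int (-k)"] by (simp add: cis_mult[symmetric])
  qed
  have "integral {0..2*pi} (\<lambda>t. ?K (t + s) - ?K t) = 0"
    using integral_shift_quasiperiodic[OF K per, of s] by simp
  moreover have "integral {0..2*pi} (\<lambda>t. ?K (t + s) - ?K t) =
      integral {0..2*pi} (\<lambda>t. ?K (t + s)) - integral {0..2*pi} ?K"
    by (intro integral_diff integrable_continuous_interval continuous_on_subset[OF K]
          continuous_on_subset[OF Ks]) auto
  ultimately have "integral {0..2*pi} (\<lambda>t. ?K (t + s)) = integral {0..2*pi} ?K" by simp
  moreover have "(\<lambda>t. f (cis (t + s)) * cis (- (of_int k * t))) = (\<lambda>t. cis (of_int k * s) * ?K (t + s))"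
    by (simp add: fun_eq_iff cis_mult algebra_simps)
  ultimately show ?thesis unfolding coef_def by (simp only: integral_mult_right times_divide_eq_right)
qed

text \<open>
  Comparing the mean square of \<open>F (t + s) + \<sigma> \<i> F t\<close> with its Fourier side evaluates the imaginary part of the
  correlation as the sum of \<open>\<bar>F^(k)\<bar>\<^sup>2 sin (k s)\<close>, and \<open>\<bar>sin (k s)\<bar> \<le> \<bar>k\<bar> \<bar>s\<bar>\<close>.
\<close>

lemma correlation_bound:
  assumes f: "continuous_on circle f" and E: "\<And>M. sobolev_sum (\<lambda>t. f (cis t)) M \<le> E"
    and \<sigma>: "\<sigma> = 1 \<or> \<sigma> = -1"
  shows "\<sigma> * integral {0..2*pi} (\<lambda>t. Im (cnj (f (cis t)) * f (cis (t + s)))) \<le> 2 * pi * \<bar>s\<bar> * E"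
proof -
  define F where "F = (\<lambda>t. f (cis t))"
  \<comment> \<open>the factor \<open>\<i>\<close> makes the cross term the imaginary part of the correlation\<close>
  define g where "g = (\<lambda>z. f (z * cis s) + of_real \<sigma> * \<i> * f z)"
  define J where "J = integral {0..2*pi} (\<lambda>t. Im (cnj (F t) * F (t + s)))"
  have F: "continuous_on UNIV F" unfolding F_def by (rule continuous_on_cis_compose[OF f])
  have Fs: "continuous_on UNIV (\<lambda>t. F (t + s))"
    by (rule continuous_on_compose2[OF F]) (auto intro!: continuous_intros)
  have g: "continuous_on circle g" unfolding g_def
    by (intro continuous_intros f continuous_on_compose2[OF f]) (auto simp: norm_mult)
  have G: "g (cis t) = F (t + s) + of_real \<sigma> * \<i> * F t" for t
    by (simp add: g_def F_def cis_mult)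
  have ii: "(\<lambda>t. F (t + s) * cis (- (of_int k * t))) integrable_on {0..2*pi}"
           "(\<lambda>t. F t * cis (- (of_int k * t))) integrable_on {0..2*pi}" for k
    by (intro integrable_continuous_interval continuous_intros continuous_on_subset[OF F]
          continuous_on_subset[OF Fs]; auto)+
  have "coef (\<lambda>t. g (cis t)) k = coef (\<lambda>t. F (t + s)) k + of_real \<sigma> * \<i> * coef F k" for k
  proof -
    have "integral {0..2*pi} (\<lambda>t. g (cis t) * cis (- (of_int k * t))) =
       integral {0..2*pi} (\<lambda>t. F (t + s) * cis (- (of_int k * t)) + of_real \<sigma> * \<i> * (F t * cis (- (of_int k * t))))"
      by (simp add: G algebra_simps)
    also have "\<dots> = integral {0..2*pi} (\<lambda>t. F (t + s) * cis (- (of_int k * t))) +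
        of_real \<sigma> * \<i> * integral {0..2*pi} (\<lambda>t. F t * cis (- (of_int k * t)))"
      by (subst integral_add) (auto intro: ii integrable_on_mult_right)
    finally show ?thesis by (simp add: coef_def add_divide_distrib)
  qed
  then have cg: "coef (\<lambda>t. g (cis t)) k = (cis (of_int k * s) + of_real \<sigma> * \<i>) * coef F k" for k
    using coef_shift[OF f, of s k] by (simp add: F_def algebra_simps)
  have c2: "(cmod (coef (\<lambda>t. g (cis t)) k))\<^sup>2 \<le> 2 * (cmod (coef F k))\<^sup>2 + 2 * \<bar>s\<bar> * (\<bar>of_int k\<bar> * (cmod (coef F k))\<^sup>2)" for k
  proof -
    have "(cmod (cis (of_int k * s) + of_real \<sigma> * \<i>))\<^sup>2 = 2 + 2 * \<sigma> * sin (of_int k * s)"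
      unfolding cmod_power2 using \<sigma> sin_cos_squared_add[of "of_int k * s"]
      by (auto simp: power2_eq_square algebra_simps)
    also have "\<dots> \<le> 2 + 2 * \<bar>of_int k * s\<bar>"
      using \<sigma> abs_sin_x_le_abs_x[of "of_int k * s"] by auto
    finally have "(cmod (cis (of_int k * s) + of_real \<sigma> * \<i>))\<^sup>2 * (cmod (coef F k))\<^sup>2 \<le>
        (2 + 2 * \<bar>of_int k * s\<bar>) * (cmod (coef F k))\<^sup>2" by (intro mult_right_mono) auto
    then show ?thesis unfolding cg norm_mult power_mult_distrib by (simp add: abs_mult algebra_simps)
  qed
  have "power_sum (\<lambda>t. g (cis t)) N \<le> 2 * mean_sq F + 2 * \<bar>s\<bar> * E" for N
  proof -
    have "power_sum (\<lambda>t. g (cis t)) N \<le> 2 * power_sum F N + 2 * \<bar>s\<bar> * sobolev_sum F N"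
      unfolding power_sum_def sobolev_sum_def sum_distrib_left sum.distrib[symmetric]
      by (intro sum_mono) (use c2 in simp)
    also have "\<dots> \<le> 2 * mean_sq F + 2 * \<bar>s\<bar> * E"
      using E by (intro add_mono mult_left_mono bessel[OF F]) (auto simp: F_def)
    finally show ?thesis .
  qed
  then have up: "mean_sq (\<lambda>t. g (cis t)) \<le> 2 * mean_sq F + 2 * \<bar>s\<bar> * E"
    by (intro LIMSEQ_le_const2[OF parseval[OF g]]) auto
  have "mean_sq (\<lambda>t. g (cis t)) = 2 * mean_sq F + 2 * \<sigma> * J / (2 * pi)"
  proof -
    have n: "(cmod (g (cis t)))\<^sup>2 = (cmod (F (t + s)))\<^sup>2 + (cmod (F t))\<^sup>2 + 2 * \<sigma> * Im (cnj (F t) * F (t + s))" for t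
    proof -
      have "\<sigma>\<^sup>2 = 1" using \<sigma> by auto
      then have "(\<sigma> * Re (F t))\<^sup>2 + (\<sigma> * Im (F t))\<^sup>2 = (Re (F t))\<^sup>2 + (Im (F t))\<^sup>2"
        by (simp add: power_mult_distrib)
      then show ?thesis
        unfolding G cmod_power2 by (simp add: power2_eq_square algebra_simps)
    qed
    have i: "(\<lambda>t. (cmod (F (t + s)))\<^sup>2) integrable_on {0..2*pi}" "(\<lambda>t. (cmod (F t))\<^sup>2) integrable_on {0..2*pi}"
        "(\<lambda>t. Im (cnj (F t) * F (t + s))) integrable_on {0..2*pi}"
      by (intro integrable_continuous_interval continuous_intros continuous_on_subset[OF F]
          continuous_on_subset[OF Fs]; auto)+
    have sq: "continuous_on UNIV (\<lambda>t. (cmod (F t))\<^sup>2)" by (intro continuous_intros F)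
    have "(cmod (F (t + 2 * pi)))\<^sup>2 = (cmod (F t))\<^sup>2 + 0" for t
      by (simp add: F_def cis_mult[symmetric])
    from integral_shift_quasiperiodic[OF sq this, of s]
    have e: "integral {0..2*pi} (\<lambda>t. (cmod (F (t + s)))\<^sup>2) = integral {0..2*pi} (\<lambda>t. (cmod (F t))\<^sup>2)"
      by (simp add: integral_diff i)
    have "integral {0..2*pi} (\<lambda>t. (cmod (g (cis t)))\<^sup>2) =
       integral {0..2*pi} (\<lambda>t. (cmod (F (t + s)))\<^sup>2) + integral {0..2*pi} (\<lambda>t. (cmod (F t))\<^sup>2) + 2 * \<sigma> * J"
      unfolding n J_def
      by (simp only: integral_add integrable_add integrable_on_mult_right i integral_mult_right)
    then show ?thesis unfolding e by (simp add: mean_sq_def add_divide_distrib)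
  qed
  with up have "\<sigma> * J / (2 * pi) \<le> \<bar>s\<bar> * E" by (simp add: field_simps)
  then show ?thesis by (simp add: J_def F_def field_simps)
qed

section \<open>Lifting circle homeomorphisms and the area bound\<close>

lemma cis_eq_cis_iff: "cis x = cis y \<longleftrightarrow> (\<exists>n::int. x = y + 2 * pi * of_int n)"
  using sin_cos_eq_iff[of x y] by (auto simp: complex_eq_iff)

lemma IVT_between:
  fixes H :: "real \<Rightarrow> real"
  assumes "continuous_on UNIV H" "a \<le> b" "min (H a) (H b) \<le> v" "v \<le> max (H a) (H b)"
  obtains t where "a \<le> t" "t \<le> b" "H t = v"
proof -
  have "continuous_on {a..b} H" using assms(1) by (rule continuous_on_subset) simp
  then show thesis
    using IVT'[of H a v b] IVT2'[of H b v a] assms(2-4) that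
    by (cases "H a \<le> H b") (auto simp: min_def max_def split: if_splits)
qed

text \<open>
  A logarithm of \<open>h \<circ> cis\<close> gives a continuous lift, which advances by a constant multiple \<open>2 \<pi> m\<close> over each period.
  Injectivity of \<open>h\<close> rules out \<open>m = 0\<close> (some value would be taken twice by the intermediate value theorem)
  and \<open>\<bar>m\<bar> \<ge> 2\<close> (the value at \<open>0\<close> would recur, modulo \<open>2 \<pi>\<close>, inside the period).
\<close>

lemma circle_lift:
  fixes h :: "complex \<Rightarrow> complex"
  assumes h: "continuous_on circle h" "inj_on h circle" "h ` circle \<subseteq> circle"
  obtains H :: "real \<Rightarrow> real" and \<epsilon> :: real where
    "continuous_on UNIV H" "\<And>t. h (cis t) = cis (H t)" "\<epsilon> = 1 \<or> \<epsilon> = -1"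
    "\<And>t. H (t + 2 * pi) = H t + 2 * pi * \<epsilon>" "\<And>s t. s \<le> t \<Longrightarrow> 0 \<le> \<epsilon> * (H t - H s)"
proof -
  have hc: "cmod (h (cis t)) = 1" for t using h(3) by (auto simp: image_subset_iff)
  have "h (cis t) \<noteq> 0" for t using hc[of t] by auto
  then obtain g where g: "continuous_on UNIV g" "\<And>t. h (cis t) = exp (g t)"
    using continuous_logarithm_on_contractible[of UNIV "\<lambda>t. h (cis t)"]
      continuous_on_cis_compose[OF h(1)] contractible_UNIV by (metis UNIV_I)
  define H where "H = (\<lambda>t. Im (g t))"
  have cH: "continuous_on UNIV H" unfolding H_def by (intro continuous_intros g)
  have Hh: "h (cis t) = cis (H t)" for t
  proof -
    have "exp (Re (g t)) = 1" using hc[of t] unfolding g(2) by simp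
    then show ?thesis unfolding g(2) H_def by (simp add: exp_eq_polar)
  qed
  have key: "\<exists>j::int. t = s + 2 * pi * of_int j" if "H t = H s + 2 * pi * of_int n" for s t and n :: int
  proof -
    have "h (cis t) = h (cis s)" unfolding Hh cis_eq_cis_iff using that by blast
    then have "cis t = cis s" using h(2) by (auto dest: inj_onD)
    then show ?thesis by (simp add: cis_eq_cis_iff)
  qed
  have "\<exists>n::int. H (t + 2 * pi) = H t + 2 * pi * of_int n" for t
  proof -
    have "cis (H (t + 2 * pi)) = cis (H t)" unfolding Hh[symmetric] by (simp add: cis_mult[symmetric])
    then show ?thesis by (simp add: cis_eq_cis_iff)
  qed
  then obtain n :: "real \<Rightarrow> int" where n: "\<And>t. H (t + 2 * pi) = H t + 2 * pi * of_int (n t)" by metis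
  define D where "D = (\<lambda>t. (H (t + 2 * pi) - H t) / (2 * pi))"
  have Dn: "D t = of_int (n t)" for t by (simp add: D_def n)
  have "continuous_on UNIV D" unfolding D_def
    by (intro continuous_intros cH continuous_on_compose2[OF cH]) auto
  then have "D constant_on UNIV"
  proof (rule continuous_discrete_range_constant[OF connected_UNIV])
    fix x :: real
    have "1 \<le> norm (D y - D x)" if "D y \<noteq> D x" for y
    proof -
      have "1 \<le> \<bar>n y - n x\<bar>" using that by (auto simp: Dn)
      then have "1 \<le> real_of_int \<bar>n y - n x\<bar>" by (simp only: of_int_1_le_iff)
      then show ?thesis by (simp add: Dn)
    qed
    then show "\<exists>e>0. \<forall>y. y \<in> UNIV \<and> D y \<noteq> D x \<longrightarrow> e \<le> norm (D y - D x)" by (intro exI[of _ 1]) auto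
  qed
  then have "n t = n 0" for t unfolding constant_on_def Dn by (metis UNIV_I of_int_eq_iff)
  then obtain m :: int where m: "\<And>t. H (t + 2 * pi) = H t + 2 * pi * of_int m" using n by metis
  have m0: "m \<noteq> 0"
  proof
    assume "m = 0"
    then have per: "H (2 * pi) = H 0" using m[of 0] by simp
    have ne: "H pi \<noteq> H 0"
    proof
      assume "H pi = H 0"
      then obtain j :: int where "pi = 2 * pi * of_int j" using key[of pi 0 0] by auto
      then have "of_int (2 * j) = (1::real)" by simp
      then show False by (metis dvd_triv_left odd_one of_int_eq_1_iff)
    qed
    \<comment> \<open>a value strictly between, taken on both halves of the period\<close>
    let ?v = "(H 0 + H pi) / 2"
    have v: "min (H 0) (H pi) \<le> ?v" "?v \<le> max (H 0) (H pi)" by (auto simp: min_def max_def)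
    obtain t where t: "0 \<le> t" "t \<le> pi" "H t = ?v"
      using IVT_between[OF cH _ v] pi_ge_zero by metis
    obtain s where s: "pi \<le> s" "s \<le> 2 * pi" "H s = ?v"
      using IVT_between[OF cH, of pi "2 * pi" ?v] v unfolding per
      by (metis min.commute max.commute pi_ge_zero mult_2 le_add_same_cancel1)
    obtain j :: int where j: "s = t + 2 * pi * of_int j" using key[of s t 0] s t by auto
    have "t \<noteq> pi" "s \<noteq> pi" "t \<noteq> 0" "s \<noteq> 2 * pi" using ne s(3) t(3) per by auto
    then have "t < pi" "pi < s" "0 < t" "s < 2 * pi" using s t by auto
    then have "0 < 2 * pi * real_of_int j" "2 * pi * real_of_int j < 2 * pi * 1" using j by linarith+
    then have "0 < j" "j < 1" by (simp_all add: zero_less_mult_iff)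
    then show False by simp
  qed
  have Hj: "H (t + 2 * pi * of_int j) = H t + 2 * pi * of_int m * of_int j" for t and j :: int
  proof (induction j rule: int_induct[where k = 0])
    case (step1 i)
    then show ?case using m[of "t + 2 * pi * of_int i"] by (simp add: algebra_simps)
  next
    case (step2 i)
    then show ?case using m[of "t + 2 * pi * of_int (i - 1)"] by (simp add: algebra_simps)
  qed simp
  have injH: "inj H"
  proof (rule injI)
    fix s t assume e: "H s = H t"
    then obtain j :: int where j: "s = t + 2 * pi * of_int j" using key[of s t 0] by auto
    have "2 * pi * of_int m * of_int j = 0" using e Hj[of t j] j by simp
    then show "s = t" using m0 j by simp
  qed
  have m1: "\<bar>m\<bar> = 1"
  proof (rule ccontr)
    assume "\<bar>m\<bar> \<noteq> 1"
    with m0 have m2: "m \<ge> 2 \<or> m \<le> -2" by linarith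
    \<comment> \<open>congruent to \<open>H 0\<close> modulo \<open>2 \<pi>\<close>, so it can only be taken at a multiple of \<open>2 \<pi>\<close>\<close>
    define v where "v = H 0 + 2 * pi * of_int (sgn m)"
    have H2: "H (2 * pi) = H 0 + 2 * pi * of_int m" using m[of 0] by simp
    have v: "min (H 0) (H (2 * pi)) < v \<and> v < max (H 0) (H (2 * pi))"
      using m2
    proof
      assume "m \<ge> 2"
      then have "pi * 2 \<le> pi * real_of_int m" "sgn m = 1" by (auto intro!: mult_left_mono)
      then show ?thesis using pi_gt_zero unfolding v_def H2 by (simp add: min_def max_def)
    next
      assume "m \<le> -2"
      then have m: "pi * real_of_int m \<le> pi * real_of_int (-2)" "sgn m = -1"
        by (auto intro!: mult_left_mono simp del: of_int_minus of_int_numeral mult_minus_right)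
      have "H (2 * pi) < v" "v < H 0"
        unfolding v_def H2 m(2) using pi_gt_zero m(1) by linarith+
      then show ?thesis by (simp add: min_less_iff_disj less_max_iff_disj)
    qed
    obtain t where t: "0 \<le> t" "t \<le> 2 * pi" "H t = v"
      using IVT_between[OF cH, of 0 "2 * pi" v] v by auto
    then obtain j :: int where j: "t = 2 * pi * of_int j" using key[of t 0 "sgn m"] by (auto simp: v_def)
    have "t \<noteq> 0" "t \<noteq> 2 * pi" using v t(3) by auto
    then have "j \<noteq> 0" "j \<noteq> 1" using j by auto
    moreover have "0 \<le> j" using t(1) pi_gt_zero unfolding j zero_le_mult_iff by linarith
    moreover have "j \<le> 1" using t(2) by (simp add: j)
    ultimately show False by linarith
  qed
  have "strict_mono_on UNIV H \<or> strict_antimono_on UNIV H"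
    using injective_eq_monotone_map[of UNIV H] cH injH by auto
  then show thesis
  proof
    assume mono: "strict_mono_on UNIV H"
    then have le: "H s \<le> H t" if "s \<le> t" for s t
      using that by (cases "s = t") (auto dest: strict_mono_onD[of UNIV H s t])
    have "m = 1"
    proof (rule ccontr)
      assume "m \<noteq> 1"
      with m1 have "m = -1" by auto
      then show False using m[of 0] le[of 0 "2 * pi"] pi_gt_zero by auto
    qed
    then show thesis using le m by (intro that[of H 1] cH Hh) auto
  next
    assume anti: "strict_antimono_on UNIV H"
    then have le: "H t \<le> H s" if "s \<le> t" for s t
      using that by (cases "s = t") (auto simp: monotone_on_def less_imp_le)
    have "m = -1"
    proof (rule ccontr)
      assume "m \<noteq> -1"
      with m1 have "m = 1" by auto
      then show False using m[of 0] le[of 0 "2 * pi"] pi_gt_zero by auto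
    qed
    then show thesis using le m by (intro that[of H "-1"] cH Hh) auto
  qed
qed

text \<open>
  The function \<open>a\<close> plays the role of twice the area swept by \<open>g\<close> up to a given angle; it is specified by a local second
  order estimate instead of an integral, so that no derivative of \<open>g\<close> occurs. Along the lift \<open>H\<close> of \<open>h\<close>, the
  integral of \<open>a (H (t + s)) - a (H t)\<close> over a period is exactly \<open>s A\<close>, up to orientation, because \<open>a \<circ> H\<close> is
  quasiperiodic. The error against the correlation is at most \<open>C\<close> times the integral of the squared increments
  of \<open>H\<close>, which is \<open>o(s)\<close> since \<open>H\<close> is monotone and uniformly continuous. The correlation itself is at most
  \<open>2 \<pi> s E\<close>; divide by \<open>s\<close>.
\<close>

lemma swept_area_le_sobolev_sum:
  fixes g h :: "complex \<Rightarrow> complex" and a :: "real \<Rightarrow> real"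
  assumes g: "continuous_on circle g"
    and h: "continuous_on circle h" "inj_on h circle" "h ` circle \<subseteq> circle"
    and E: "\<And>M. sobolev_sum (\<lambda>t. g (h (cis t))) M \<le> E"
    and per: "\<And>x. a (x + 2 * pi) = a x + A" and C: "0 \<le> C"
    and area: "\<And>x y. \<bar>y - x\<bar> \<le> 1 \<Longrightarrow>
      \<bar>Im (cnj (g (cis x)) * g (cis y)) - (a y - a x)\<bar> \<le> C * (y - x)\<^sup>2"
  shows "A \<le> 2 * pi * E"
proof -
  obtain H \<epsilon> where H: "continuous_on UNIV H" "\<And>t. h (cis t) = cis (H t)" and \<epsilon>: "\<epsilon> = 1 \<or> \<epsilon> = (-1::real)"
    and perH: "\<And>t. H (t + 2 * pi) = H t + 2 * pi * \<epsilon>" and mono: "\<And>s t. s \<le> t \<Longrightarrow> 0 \<le> \<epsilon> * (H t - H s)"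
    using circle_lift[OF h] by metis
  have ee: "\<epsilon> * \<epsilon> = 1" using \<epsilon> by auto
  have gh: "continuous_on circle (\<lambda>z. g (h z))"
    using continuous_on_compose2[OF g h(1) h(3)] by simp
  have gc: "continuous_on UNIV (\<lambda>x. g (cis x))" by (rule continuous_on_cis_compose[OF g])
  have ca: "continuous_on UNIV a"
  proof (rule continuous_at_imp_continuous_on, rule ballI)
    fix x
    have "((\<lambda>y. \<bar>Im (cnj (g (cis x)) * g (cis y))\<bar> + C * (y - x)\<^sup>2) \<longlongrightarrow>
        \<bar>Im (cnj (g (cis x)) * g (cis x))\<bar> + C * (x - x)\<^sup>2) (at x)"
      using gc by (intro tendsto_intros) (auto simp: continuous_on_eq_continuous_at isCont_def)
    then have "((\<lambda>y. \<bar>Im (cnj (g (cis x)) * g (cis y))\<bar> + C * (y - x)\<^sup>2) \<longlongrightarrow> 0) (at x)"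
      by (simp add: mult.commute)
    then have "((\<lambda>y. a y - a x) \<longlongrightarrow> 0) (at x)"
    proof (rule Lim_null_comparison[rotated])
      have "\<forall>\<^sub>F y in at x. dist y x < 1" by (auto simp: eventually_at intro: exI[of _ 1])
      then show "\<forall>\<^sub>F y in at x. norm (a y - a x) \<le> \<bar>Im (cnj (g (cis x)) * g (cis y))\<bar> + C * (y - x)\<^sup>2"
      proof eventually_elim
        case (elim y)
        then have "\<bar>Im (cnj (g (cis x)) * g (cis y)) - (a y - a x)\<bar> \<le> C * (y - x)\<^sup>2"
          by (intro area) (simp add: dist_real_def)
        then show ?case unfolding real_norm_def by linarith
      qed
    qed
    then show "isCont a x" using LIM_zero_cancel isCont_def by blast
  qed
  have caH: "continuous_on UNIV (\<lambda>t. a (H t))" by (rule continuous_on_compose2[OF ca H(1)]) auto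
  have per_aH: "a (H (t + 2 * pi)) = a (H t) + \<epsilon> * A" for t
    using \<epsilon> per[of "H t"] per[of "H t - 2 * pi"] unfolding perH by auto
  have main: "A \<le> 2 * pi * E + C * \<eta> * (2 * pi)" if \<eta>: "0 < \<eta>" "\<eta> \<le> 1" for \<eta>
  proof -
    have "uniformly_continuous_on {0..2*pi+1} H"
      by (intro compact_uniformly_continuous continuous_on_subset[OF H(1)]) auto
    then obtain d where d: "d > 0"
      "\<And>x y. x \<in> {0..2*pi+1} \<Longrightarrow> y \<in> {0..2*pi+1} \<Longrightarrow> dist y x < d \<Longrightarrow> dist (H y) (H x) < \<eta>"
      unfolding uniformly_continuous_on_def using \<eta>(1) by metis
    define s where "s = min (d/2) 1"
    have s: "0 < s" "s < d" "s \<le> 1" using d(1) by (auto simp: s_def)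
    define c where "c = (\<lambda>t. Im (cnj (g (h (cis t))) * g (h (cis (t + s)))))"
    have cHs: "continuous_on UNIV (\<lambda>t. H (t + s))"
      by (rule continuous_on_compose2[OF H(1)]) (auto intro!: continuous_intros)
    have i1: "c integrable_on {0..2*pi}"
    proof -
      have G: "continuous_on UNIV (\<lambda>t. g (h (cis t)))" by (rule continuous_on_cis_compose[OF gh])
      have "continuous_on UNIV (\<lambda>t. g (h (cis (t + s))))"
        by (rule continuous_on_compose2[OF G]) (auto intro!: continuous_intros)
      with G show ?thesis unfolding c_def
        by (intro integrable_continuous_interval continuous_intros) (auto elim: continuous_on_subset)
    qed
    have i2: "(\<lambda>t. a (H (t + s)) - a (H t)) integrable_on {0..2*pi}"
      by (intro integrable_continuous_interval continuous_intros continuous_on_subset[OF caH]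
           continuous_on_subset[OF continuous_on_compose2[OF ca cHs]]) auto
    have i3: "(\<lambda>t. H (t + s) - H t) integrable_on {0..2*pi}"
      by (intro integrable_continuous_interval continuous_intros continuous_on_subset[OF H(1)]
           continuous_on_subset[OF cHs]) auto
    have "integral {0..2*pi} (\<lambda>t. \<epsilon> * (a (H (t + s)) - a (H t)) - C * \<eta> * (\<epsilon> * (H (t + s) - H t)))
        \<le> integral {0..2*pi} (\<lambda>t. \<epsilon> * c t)"
    proof (rule integral_le)
      fix t assume t: "t \<in> {0..2*pi}"
      let ?D = "H (t + s) - H t"
      have "dist (H (t + s)) (H t) < \<eta>" using t s by (intro d(2)) (auto simp: dist_real_def)
      then have D: "\<bar>?D\<bar> \<le> \<eta>" by (simp add: dist_real_def)
      have "\<bar>c t - (a (H (t + s)) - a (H t))\<bar> \<le> C * ?D\<^sup>2"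
        unfolding c_def H(2) using area D \<eta>(2) by simp
      also have "?D\<^sup>2 = \<bar>?D\<bar> * (\<epsilon> * ?D)"
        using mono[of t "t + s"] s(1) \<epsilon> by (auto simp: power2_eq_square abs_if)
      also have "C * (\<bar>?D\<bar> * (\<epsilon> * ?D)) \<le> C * (\<eta> * (\<epsilon> * ?D))"
        using mono[of t "t + s"] s(1) D C by (intro mult_left_mono mult_right_mono) auto
      finally show "\<epsilon> * (a (H (t + s)) - a (H t)) - C * \<eta> * (\<epsilon> * ?D) \<le> \<epsilon> * c t"
        using \<epsilon> by (auto simp: mult.assoc)
    qed (intro integrable_diff integrable_on_mult_right i1 i2 i3)+
    also have "integral {0..2*pi} (\<lambda>t. \<epsilon> * (a (H (t + s)) - a (H t)) - C * \<eta> * (\<epsilon> * (H (t + s) - H t)))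
       = \<epsilon> * (s * (\<epsilon> * A)) - C * \<eta> * (\<epsilon> * (s * (2 * pi * \<epsilon>)))"
      using integral_shift_quasiperiodic[OF caH per_aH, of s] integral_shift_quasiperiodic[OF H(1) perH, of s]
      by (simp only: integral_diff integrable_on_mult_right i2 i3 integral_mult_right real_scaleR_def)
    also have "\<dots> = s * (A - C * \<eta> * (2 * pi))"
      using \<epsilon> by (auto simp: algebra_simps)
    also have "integral {0..2*pi} (\<lambda>t. \<epsilon> * c t) \<le> 2 * pi * \<bar>s\<bar> * E"
      using correlation_bound[OF gh E \<epsilon>, of s] by (simp only: c_def integral_mult_right)
    also have "\<dots> = s * (2 * pi * E)" using s by simp
    finally have "A - C * \<eta> * (2 * pi) \<le> 2 * pi * E" using s(1) by (simp only: mult_le_cancel_left_pos)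
    then show ?thesis by simp
  qed
  show ?thesis
  proof (rule field_le_epsilon)
    fix e :: real assume e: "e > 0"
    define \<eta> where "\<eta> = min 1 (e / (C * (2 * pi) + 1))"
    have pos: "C * (2 * pi) + 1 > 0" using C by (simp add: add_nonneg_pos)
    have "\<eta> * (C * (2 * pi)) \<le> \<eta> * (C * (2 * pi) + 1)" using e pos by (intro mult_left_mono) (auto simp: \<eta>_def)
    also have "\<dots> \<le> e / (C * (2 * pi) + 1) * (C * (2 * pi) + 1)" using pos by (intro mult_right_mono) (auto simp: \<eta>_def)
    also have "\<dots> = e" using pos by simp
    finally have "C * \<eta> * (2 * pi) \<le> e" by (simp add: mult_ac)
    moreover have "A \<le> 2 * pi * E + C * \<eta> * (2 * pi)"
      using e pos by (intro main) (auto simp: \<eta>_def)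
    ultimately show "A \<le> 2 * pi * E + e" by linarith
  qed
qed

section \<open>Area swept by one rotating bump\<close>

lemma abs_sin_minus_self_le: "\<bar>sin u - u\<bar> \<le> u\<^sup>2" for u :: real
proof (cases "\<bar>u\<bar> \<le> 2")
  case True
  have "\<bar>sin u - (\<Sum>i<2. sin_coeff i * u ^ i)\<bar> \<le> inverse (fact 2) * \<bar>u\<bar> ^ 2"
    by (rule Maclaurin_sin_bound)
  then have "\<bar>sin u - u\<bar> \<le> u\<^sup>2 / 2"
    by (simp add: sin_coeff_def numeral_2_eq_2)
  then show ?thesis by (smt (verit) zero_le_power2 field_sum_of_halves)
next
  case False
  have "\<bar>sin u - u\<bar> \<le> 2 * \<bar>u\<bar>" using abs_sin_x_le_abs_x[of u] by linarith
  also have "\<dots> \<le> \<bar>u\<bar> * \<bar>u\<bar>" using False by (intro mult_right_mono) auto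
  finally show ?thesis by (simp add: power2_eq_square)
qed

definition phase :: "real \<Rightarrow> real \<Rightarrow> real \<Rightarrow> real \<Rightarrow> real" where
  "phase c w \<nu> x = \<nu> * max (- w) (min w (x - c))"

lemma phase_Lipschitz: "0 \<le> \<nu> \<Longrightarrow> \<bar>phase c w \<nu> y - phase c w \<nu> x\<bar> \<le> \<nu> * \<bar>y - x\<bar>"
  unfolding phase_def right_diff_distrib[symmetric] abs_mult by (auto intro!: mult_left_mono)

lemma phase_before: "0 \<le> w \<Longrightarrow> x \<le> c - w \<Longrightarrow> phase c w \<nu> x = - (\<nu> * w)"
  by (simp add: phase_def max_absorb1 min.coboundedI2)

lemma phase_after: "0 \<le> w \<Longrightarrow> c + w \<le> x \<Longrightarrow> phase c w \<nu> x = \<nu> * w"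
  by (simp add: phase_def max_def min_def)

text \<open>
  Where the phase moves, the modulus is constant and the estimate is \<open>\<bar>sin u - u\<bar> \<le> u\<^sup>2\<close>. If only part of the
  way between \<open>x\<close> and \<open>y\<close> lies in the plateau, then both points are within \<open>\<bar>x - y\<bar>\<close> of a plateau point, so the
  moduli deviate from \<open>r\<close> by an amount of first order, which is multiplied by a phase increment of first order.
  Radial motion sweeps no area, hence the phases at the two ends of the bump need not agree.
\<close>

lemma spinning_area:
  fixes R :: "real \<Rightarrow> real"
  assumes "0 \<le> w" "0 \<le> \<nu>" "0 \<le> K" and Lip: "\<And>x y. \<bar>R x - R y\<bar> \<le> K * \<bar>x - y\<bar>"
    and R: "\<And>x. 0 \<le> R x" "\<And>x. R x \<le> r" and plateau: "\<And>x. \<bar>x - c\<bar> \<le> w \<Longrightarrow> R x = r"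
  shows "\<bar>R x * R y * sin (phase c w \<nu> y - phase c w \<nu> x) - r\<^sup>2 * (phase c w \<nu> y - phase c w \<nu> x)\<bar>
    \<le> (2 * K * r * \<nu> + r\<^sup>2 * \<nu>\<^sup>2) * (y - x)\<^sup>2"
proof (cases "phase c w \<nu> y = phase c w \<nu> x")
  case True
  have "0 \<le> r" using R[of 0] by linarith
  with assms True show ?thesis by simp
next
  case False
  have r: "0 \<le> r" using R[of 0] by linarith
  let ?u = "phase c w \<nu> y - phase c w \<nu> x"
  have u: "\<bar>?u\<bar> \<le> \<nu> * \<bar>y - x\<bar>" by (rule phase_Lipschitz) fact
  \<comment> \<open>the point of the plateau nearest to \<open>x\<close>; it lies between \<open>x\<close> and \<open>y\<close> because the phases differ\<close>
  define p where "p = max (c - w) (min (c + w) x)"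
  have "max (- w) (min w (y - c)) \<noteq> max (- w) (min w (x - c))" using False by (auto simp: phase_def)
  then have p: "\<bar>x - p\<bar> \<le> \<bar>x - y\<bar>" "\<bar>y - p\<bar> \<le> \<bar>x - y\<bar>" and "\<bar>p - c\<bar> \<le> w"
    using \<open>0 \<le> w\<close> by (auto simp: p_def max_def min_def split: if_splits)
  then have Rp: "R p = r" by (intro plateau)
  have near: "\<bar>R z - r\<bar> \<le> K * \<bar>x - y\<bar>" if "\<bar>z - p\<bar> \<le> \<bar>x - y\<bar>" for z
    using Lip[of z p] mult_left_mono[OF that \<open>0 \<le> K\<close>] unfolding Rp by linarith
  have "R x * R y - r\<^sup>2 = R x * (R y - r) + (R x - r) * r" by (simp add: algebra_simps power2_eq_square)
  also have "\<bar>\<dots>\<bar> \<le> \<bar>R x\<bar> * \<bar>R y - r\<bar> + \<bar>R x - r\<bar> * \<bar>r\<bar>"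
    by (metis abs_mult abs_triangle_ineq)
  also have "\<dots> \<le> r * (K * \<bar>x - y\<bar>) + (K * \<bar>x - y\<bar>) * r"
    using R[of x] r near[OF p(1)] near[OF p(2)] by (intro add_mono mult_mono) auto
  finally have prod: "\<bar>R x * R y - r\<^sup>2\<bar> \<le> 2 * K * r * \<bar>y - x\<bar>" by (simp add: algebra_simps abs_minus_commute)
  have "R x * R y * sin ?u - r\<^sup>2 * ?u = (R x * R y - r\<^sup>2) * sin ?u + r\<^sup>2 * (sin ?u - ?u)"
    by (simp add: algebra_simps)
  also have "\<bar>\<dots>\<bar> \<le> \<bar>R x * R y - r\<^sup>2\<bar> * \<bar>sin ?u\<bar> + r\<^sup>2 * \<bar>sin ?u - ?u\<bar>"
    by (metis abs_mult abs_triangle_ineq abs_power2)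
  also have "\<dots> \<le> (2 * K * r * \<bar>y - x\<bar>) * (\<nu> * \<bar>y - x\<bar>) + r\<^sup>2 * (\<nu> * \<bar>y - x\<bar>)\<^sup>2"
  proof (intro add_mono mult_mono prod mult_left_mono)
    show "\<bar>sin ?u\<bar> \<le> \<nu> * \<bar>y - x\<bar>" using abs_sin_x_le_abs_x[of ?u] u by linarith
    have "\<bar>sin ?u - ?u\<bar> \<le> \<bar>?u\<bar>\<^sup>2" using abs_sin_minus_self_le[of ?u] by simp
    also have "\<dots> \<le> (\<nu> * \<bar>y - x\<bar>)\<^sup>2" by (intro power_mono u) auto
    finally show "\<bar>sin ?u - ?u\<bar> \<le> (\<nu> * \<bar>y - x\<bar>)\<^sup>2" .
  qed (use assms r in auto)
  also have "\<dots> = (2 * K * r * \<nu> + r\<^sup>2 * \<nu>\<^sup>2) * (y - x)\<^sup>2"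
    by (simp add: algebra_simps power2_eq_square power_mult_distrib flip: abs_mult)
  finally show ?thesis .
qed

section \<open>Radial shells\<close>

text \<open>
  In polar coordinates the map moves radii to the interval from \<open>0\<close> to \<open>r / 2\<close>: it vanishes for radii at most
  \<open>r / 2\<close> and equals \<open>r / 2\<close> for radii at least \<open>r\<close>. Writing it as a difference of nearest point
  projections makes its Lipschitz constant independent of \<open>r\<close>.
\<close>

definition shell :: "real \<Rightarrow> complex \<Rightarrow> complex" where
  "shell r z = closest_point (cball 0 r) z - closest_point (cball 0 (r / 2)) z"

lemma closest_point_cball_polar:
  assumes "0 \<le> r" "0 \<le> \<rho>"
  shows "closest_point (cball 0 r) (of_real \<rho> * cis \<theta>) = of_real (min \<rho> r) * cis \<theta>"
proof (rule closest_point_unique[symmetric])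
  show "of_real (min \<rho> r) * cis \<theta> \<in> cball 0 r" using assms by (simp add: norm_mult)
  show "\<forall>z\<in>cball 0 r. dist (of_real \<rho> * cis \<theta>) (of_real (min \<rho> r) * cis \<theta>) \<le> dist (of_real \<rho> * cis \<theta>) z"
  proof
    fix z :: complex assume z: "z \<in> cball 0 r"
    have "dist (of_real \<rho> * cis \<theta>) (of_real (min \<rho> r) * cis \<theta>) = \<rho> - min \<rho> r"
    proof -
      have "of_real \<rho> * cis \<theta> - of_real (min \<rho> r) * cis \<theta> = of_real (\<rho> - min \<rho> r) * cis \<theta>"
        by (simp add: algebra_simps)
      then show ?thesis unfolding dist_norm by (simp only: norm_mult norm_cis norm_of_real) simp
    qed
    also have "\<dots> \<le> dist (of_real \<rho> * cis \<theta>) z"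
    proof (cases "\<rho> \<le> r")
      case False
      have "\<rho> = cmod (of_real \<rho> * cis \<theta>)" using assms by (simp add: norm_mult)
      also have "\<dots> \<le> dist (of_real \<rho> * cis \<theta>) z + cmod z"
        by (metis add.commute dist_norm norm_triangle_sub)
      finally show ?thesis using z False by simp
    qed simp
    finally show "dist (of_real \<rho> * cis \<theta>) (of_real (min \<rho> r) * cis \<theta>) \<le> dist (of_real \<rho> * cis \<theta>) z" .
  qed
qed auto

lemma shell_polar:
  assumes "0 \<le> r" "0 \<le> \<rho>"
  shows "shell r (of_real \<rho> * cis \<theta>) = of_real (min \<rho> r - min \<rho> (r / 2)) * cis \<theta>"
  using assms by (simp add: shell_def closest_point_cball_polar left_diff_distrib)

lemma shell_Lipschitz:
  assumes "0 \<le> r"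
  shows "cmod (shell r z - shell r w) \<le> 2 * cmod (z - w)"
proof -
  have "dist (closest_point (cball 0 s) z) (closest_point (cball 0 s) w) \<le> dist z w" if "0 \<le> s" for s
    using that by (intro closest_point_lipschitz) auto
  from this[of r] this[of "r / 2"] assms show ?thesis
    unfolding shell_def dist_norm
    using norm_triangle_ineq4[of "closest_point (cball 0 r) z - closest_point (cball 0 r) w"
        "closest_point (cball 0 (r / 2)) z - closest_point (cball 0 (r / 2)) w"]
    by (simp add: algebra_simps)
qed

lemma continuous_on_shell: "0 \<le> r \<Longrightarrow> continuous_on S (shell r)"
  unfolding shell_def by (intro continuous_intros continuous_on_closest_point) auto

section \<open>The loop with infinitely many rotating bumps\<close>

definition half_width :: "nat \<Rightarrow> real" where
  "half_width n = (1 / 2) ^ n / 4"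

definition centre :: "nat \<Rightarrow> real" where
  "centre n = 1 + 3 * half_width n"

text \<open>
  The \<open>n\<close>-th window runs from \<open>1 + 2 e\<close> to \<open>1 + 4 e\<close> with \<open>e = half_width n\<close>, so consecutive windows abut.
  All of them lie in \<open>{1..2}\<close>: two angles at distance at most \<open>1\<close> can be moved into \<open>{0..2*pi+1}\<close> by the same
  multiple of \<open>2 \<pi>\<close>, and there is no bump on \<open>{0..1}\<close> and \<open>{2..2*pi+1}\<close>.
\<close>

definition window :: "nat \<Rightarrow> real set" where
  "window n = {x. \<bar>x - centre n\<bar> < half_width n}"

lemma half_width: "0 < half_width n" "half_width n \<le> 1 / 4"
  by (simp_all add: half_width_def power_le_one)

lemma half_width_Suc_le: "n < m \<Longrightarrow> 2 * half_width m \<le> half_width n"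
  using power_decreasing[of "Suc n" m "1 / 2 :: real"] by (simp add: half_width_def)

lemma window_bounds: "x \<in> window n \<Longrightarrow> 1 < x \<and> x < 2"
  using half_width[of n] by (auto simp: window_def centre_def)

lemma window_disjoint: "x \<in> window n \<Longrightarrow> x \<in> window m \<Longrightarrow> n = m"
proof (induction n m rule: linorder_wlog)
  case (le n m)
  show ?case
  proof (rule ccontr)
    assume "n \<noteq> m"
    with le have "2 * half_width m \<le> half_width n" by (intro half_width_Suc_le) auto
    with le show False by (auto simp: window_def centre_def)
  qed
qed auto

text \<open>
  A trapezoid of slope \<open>1\<close> and height \<open>r\<close>; for \<open>r \<le> half_width n / 2\<close> its plateau contains the middle half of the
  window, which is where the phase of the bump moves.
\<close>

definition amp :: "nat \<Rightarrow> real \<Rightarrow> real \<Rightarrow> real" where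
  "amp n r x = max 0 (min r (half_width n - \<bar>x - centre n\<bar>))"

definition bump :: "nat \<Rightarrow> real \<Rightarrow> real \<Rightarrow> real \<Rightarrow> complex" where
  "bump n r \<nu> x = of_real (amp n r x) * cis (phase (centre n) (half_width n / 2) \<nu> x)"

lemma amp_bounds: "0 \<le> amp n r x" "0 \<le> r \<Longrightarrow> amp n r x \<le> r"
  by (auto simp: amp_def)

lemma amp_Lipschitz: "\<bar>amp n r x - amp n r y\<bar> \<le> \<bar>x - y\<bar>"
  using abs_triangle_ineq3[of "x - centre n" "y - centre n"]
  by (auto simp: amp_def max_def min_def abs_minus_commute)

lemma amp_eq_0: "x \<notin> window n \<Longrightarrow> amp n r x = 0"
  by (auto simp: amp_def window_def)

lemma amp_plateau: "0 \<le> r \<Longrightarrow> r \<le> half_width n / 2 \<Longrightarrow> \<bar>x - centre n\<bar> \<le> half_width n / 2 \<Longrightarrow> amp n r x = r"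
  by (auto simp: amp_def)

lemma cmod_cis_diff_le: "cmod (cis x - cis y) \<le> \<bar>x - y\<bar>"
proof -
  have "cmod (cis x - cis y) = cmod (exp (\<i> * x) - exp (\<i> * y))" by (simp add: cis_conv_exp)
  also have "\<dots> = cmod (exp (\<i> * of_real (x - y)) - 1)"
  proof -
    have "exp (\<i> * x) - exp (\<i> * y) = exp (\<i> * y) * (exp (\<i> * of_real (x - y)) - 1)"
      by (simp add: algebra_simps flip: exp_add)
    then show ?thesis by (simp add: norm_mult)
  qed
  also have "\<dots> = 2 * \<bar>sin ((x - y) / 2)\<bar>" by (rule dist_exp_i_1)
  also have "\<dots> \<le> \<bar>x - y\<bar>" using abs_sin_x_le_abs_x[of "(x - y) / 2"] by simp
  finally show ?thesis .
qed

lemma bump_diff_le: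
  assumes "0 \<le> r" "0 \<le> \<nu>"
  shows "cmod (bump n r \<nu> x - bump n r \<nu> y) \<le> \<bar>x - y\<bar> + r * min 2 (\<nu> * \<bar>x - y\<bar>)"
proof -
  let ?\<theta> = "phase (centre n) (half_width n / 2) \<nu>"
  have "bump n r \<nu> x - bump n r \<nu> y =
      of_real (amp n r x - amp n r y) * cis (?\<theta> x) + of_real (amp n r y) * (cis (?\<theta> x) - cis (?\<theta> y))"
    by (simp add: bump_def algebra_simps)
  also have "cmod \<dots> \<le> cmod (of_real (amp n r x - amp n r y) * cis (?\<theta> x)) + cmod (of_real (amp n r y) * (cis (?\<theta> x) - cis (?\<theta> y)))"
    by (rule norm_triangle_ineq)
  also have "\<dots> = \<bar>amp n r x - amp n r y\<bar> + amp n r y * cmod (cis (?\<theta> x) - cis (?\<theta> y))"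
    by (simp only: norm_mult norm_of_real norm_cis) (simp add: amp_bounds)
  also have "\<dots> \<le> \<bar>x - y\<bar> + r * min 2 (\<nu> * \<bar>x - y\<bar>)"
  proof (intro add_mono amp_Lipschitz mult_mono)
    show "cmod (cis (?\<theta> x) - cis (?\<theta> y)) \<le> min 2 (\<nu> * \<bar>x - y\<bar>)"
      using norm_triangle_ineq4[of "cis (?\<theta> x)" "cis (?\<theta> y)"] cmod_cis_diff_le[of "?\<theta> x" "?\<theta> y"]
        phase_Lipschitz[OF assms(2), of "centre n" "half_width n / 2" x y] by auto
  qed (use assms amp_bounds in auto)
  finally show ?thesis .
qed

text \<open>
  At most one bump is nonzero at each point. Outside all windows the choice of the index is arbitrary, but then
  every bump vanishes.
\<close>

definition bump_train :: "(nat \<Rightarrow> real) \<Rightarrow> (nat \<Rightarrow> real) \<Rightarrow> real \<Rightarrow> complex" where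
  "bump_train r \<nu> x = (let n = SOME n. x \<in> window n in bump n (r n) (\<nu> n) x)"

lemma bump_train_in_window: "x \<in> window n \<Longrightarrow> bump_train r \<nu> x = bump n (r n) (\<nu> n) x"
  unfolding bump_train_def Let_def by (metis someI window_disjoint)

lemma bump_train_outside: "(\<And>n. x \<notin> window n) \<Longrightarrow> bump_train r \<nu> x = 0"
  unfolding bump_train_def Let_def by (simp add: bump_def amp_eq_0)

text \<open>
  If no window contains both points, then each value is itself a difference of values of one bump,
  because that bump vanishes at the other point. This is the reason for the factor \<open>2\<close>.
\<close>

lemma bump_train_diff_le:
  assumes bd: "\<And>n. cmod (bump n (r n) (\<nu> n) x - bump n (r n) (\<nu> n) y) \<le> b"
  shows "cmod (bump_train r \<nu> x - bump_train r \<nu> y) \<le> 2 * b"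
proof -
  have b: "0 \<le> b" using bd[of 0] norm_ge_zero order_trans by blast
  have z: "bump n (r n) (\<nu> n) u = 0" if "u \<notin> window n" for n u
    using that by (simp add: bump_def amp_eq_0)
  have one: "cmod (bump_train r \<nu> u) \<le> b"
    if "\<And>n. u \<in> window n \<Longrightarrow> v \<notin> window n" "{u, v} = {x, y}" for u v
  proof (cases "\<exists>n. u \<in> window n")
    case True
    then obtain n where n: "u \<in> window n" by blast
    then have "bump_train r \<nu> u = bump n (r n) (\<nu> n) u - bump n (r n) (\<nu> n) v"
      using that z by (simp add: bump_train_in_window)
    then show ?thesis using bd[of n] that(2) by (metis doubleton_eq_iff norm_minus_commute)
  qed (simp add: bump_train_outside b)
  show ?thesis
  proof (cases "\<exists>n. x \<in> window n \<and> y \<in> window n")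
    case True
    then obtain n where "x \<in> window n" "y \<in> window n" by blast
    then show ?thesis using bd[of n] b by (simp add: bump_train_in_window)
  next
    case False
    then have "cmod (bump_train r \<nu> x) \<le> b" "cmod (bump_train r \<nu> y) \<le> b"
      using one[of x y] one[of y x] by blast+
    then show ?thesis using norm_triangle_ineq4[of "bump_train r \<nu> x" "bump_train r \<nu> y"] by linarith
  qed
qed

definition circle_train :: "(nat \<Rightarrow> real) \<Rightarrow> (nat \<Rightarrow> real) \<Rightarrow> complex \<Rightarrow> complex" where
  "circle_train r \<nu> z = bump_train r \<nu> (Arg2pi z)"

lemma circle_train_cis:
  assumes "x \<in> {0..2*pi+1}"
  shows "circle_train r \<nu> (cis x) = bump_train r \<nu> x"
proof (cases "x < 2 * pi")
  case True
  then have "Arg2pi (cis x) = x" using assms Arg2pi_unique[of 1 x "cis x"] by (simp add: cis_conv_exp)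
  then show ?thesis by (simp add: circle_train_def)
next
  case False
  have "cis x = cis (x - 2 * pi)" unfolding cis_eq_cis_iff by (rule exI[of _ 1]) simp
  then have "Arg2pi (cis x) = x - 2 * pi"
    using assms False pi_gt3 Arg2pi_unique[of 1 "x - 2 * pi" "cis x"] by (simp add: cis_conv_exp)
  moreover have "bump_train r \<nu> (x - 2 * pi) = 0" "bump_train r \<nu> x = 0"
    using assms False pi_gt3 by (auto intro!: bump_train_outside dest!: window_bounds)
  ultimately show ?thesis by (simp add: circle_train_def)
qed

lemma circle_train_diff_le:
  assumes bd: "\<And>n x y. \<bar>x - y\<bar> \<le> 1 \<Longrightarrow> cmod (bump n (r n) (\<nu> n) x - bump n (r n) (\<nu> n) y) \<le> b \<bar>x - y\<bar>"
    and "\<bar>s - t\<bar> \<le> 1"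
  shows "cmod (circle_train r \<nu> (cis s) - circle_train r \<nu> (cis t)) \<le> 2 * b \<bar>s - t\<bar>"
proof -
  define j where "j = \<lfloor>min s t / (2 * pi)\<rfloor>"
  let ?s = "s - 2 * pi * of_int j" and ?t = "t - 2 * pi * of_int j"
  have c: "cis (z - 2 * pi * of_int j) = cis z" for z
    unfolding cis_eq_cis_iff by (rule exI[of _ "- j"]) simp
  have "of_int j \<le> min s t / (2 * pi)" unfolding j_def by (rule of_int_floor_le)
  then have 1: "2 * pi * of_int j \<le> min s t" by (simp add: pos_le_divide_eq mult_ac)
  have "min s t / (2 * pi) < of_int j + 1" unfolding j_def by linarith
  then have 2: "min s t < 2 * pi * of_int j + 2 * pi" by (simp add: pos_divide_less_eq algebra_simps)
  have "?s \<in> {0..2*pi+1}" "?t \<in> {0..2*pi+1}" using 1 2 assms(2) by auto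
  then have "circle_train r \<nu> (cis s) = bump_train r \<nu> ?s" "circle_train r \<nu> (cis t) = bump_train r \<nu> ?t"
    using circle_train_cis c by metis+
  moreover have "cmod (bump_train r \<nu> ?s - bump_train r \<nu> ?t) \<le> 2 * b \<bar>s - t\<bar>"
    using bd[of ?s ?t] assms(2) by (intro bump_train_diff_le) simp
  ultimately show ?thesis by simp
qed

text \<open>
  Near \<open>z\<close> the angle is a continuous function of \<open>w\<close>, namely the angle of \<open>z\<close> plus the imaginary part of
  \<open>Ln (w / z)\<close>.
\<close>

lemma continuous_on_circleI:
  assumes "continuous_on UNIV (\<lambda>t. f (cis t))"
  shows "continuous_on circle (f :: complex \<Rightarrow> complex)"
proof (subst continuous_on_eq_continuous_within, rule ballI)
  fix z :: complex assume z: "z \<in> circle"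
  then obtain t where t: "z = cis t"
    using complex_norm_eq_1_exp[of z] by (metis cis_conv_exp mem_sphere_0)
  define G where "G = (\<lambda>w. f (cis (t + Im (Ln (w / z)))))"
  have z0: "z \<noteq> 0" using z by auto
  have ct: "isCont (\<lambda>t. f (cis t)) x" for x
    using assms by (simp add: continuous_on_eq_continuous_at)
  have "isCont (\<lambda>w. t + Im (Ln (w / z))) z"
    using z0 by (intro continuous_intros) auto
  then have "isCont G z" unfolding G_def by (rule isCont_o2[OF _ ct])
  moreover have fG: "f w = G w" if "w \<in> circle" for w
  proof -
    have n: "cmod (w / z) = 1" using that z by (simp add: norm_divide)
    then have "w / z \<noteq> 0" by auto
    then have "w / z = exp (Ln (w / z))" by simp
    also have "\<dots> = cis (Im (Ln (w / z)))" using n \<open>w / z \<noteq> 0\<close> by (simp add: exp_eq_polar)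
    finally have "w = z * cis (Im (Ln (w / z)))" using z0 by (simp add: field_simps)
    then show ?thesis by (simp add: G_def t cis_mult[symmetric])
  qed
  ultimately show "continuous (at z within circle) f"
    using z by (metis continuous_at_imp_continuous_at_within continuous_within continuous_transform_within zero_less_one)
qed

section \<open>Area swept inside one shell\<close>

text \<open>
  Copies of \<open>a\<^sub>0\<close>, translated by multiples of \<open>2 \<pi>\<close> and raised by the same multiples of the increment, agree on
  overlaps of length \<open>1\<close> because \<open>a\<^sub>0\<close> is constant near both ends. The overlap lets the estimate cross the
  multiples of \<open>2 \<pi>\<close>.
\<close>

lemma periodic_swept_area:
  fixes g :: "complex \<Rightarrow> complex" and a\<^sub>0 :: "real \<Rightarrow> real"
  assumes area: "\<And>x y. x \<in> {0..2*pi+1} \<Longrightarrow> y \<in> {0..2*pi+1} \<Longrightarrow>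
      \<bar>Im (cnj (g (cis x)) * g (cis y)) - (a\<^sub>0 y - a\<^sub>0 x)\<bar> \<le> C * (y - x)\<^sup>2"
    and left: "\<And>x. x \<in> {0..1} \<Longrightarrow> a\<^sub>0 x = a\<^sub>0 0"
    and right: "\<And>x. x \<in> {2*pi..2*pi+1} \<Longrightarrow> a\<^sub>0 x = a\<^sub>0 (2 * pi)"
  obtains a :: "real \<Rightarrow> real" where "\<And>x. a (x + 2 * pi) = a x + (a\<^sub>0 (2 * pi) - a\<^sub>0 0)"
    "\<And>x y. \<bar>y - x\<bar> \<le> 1 \<Longrightarrow> \<bar>Im (cnj (g (cis x)) * g (cis y)) - (a y - a x)\<bar> \<le> C * (y - x)\<^sup>2"
proof -
  define A where "A = a\<^sub>0 (2 * pi) - a\<^sub>0 0"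
  define k where "k = (\<lambda>x::real. \<lfloor>x / (2 * pi)\<rfloor>)"
  define a where "a = (\<lambda>x. a\<^sub>0 (x - 2 * pi * of_int (k x)) + A * of_int (k x))"
  have kx: "k x = j" if "2 * pi * of_int j \<le> x" "x < 2 * pi * of_int j + 2 * pi" for x and j :: int
    unfolding k_def using that by (intro floor_unique) (auto simp: field_simps)
  have k: "2 * pi * of_int (k x) \<le> x" "x < 2 * pi * of_int (k x) + 2 * pi" for x
  proof -
    have "of_int (k x) \<le> x / (2 * pi)" unfolding k_def by (rule of_int_floor_le)
    then show "2 * pi * of_int (k x) \<le> x" by (simp add: pos_le_divide_eq mult_ac)
    have "x / (2 * pi) < of_int (k x) + 1" unfolding k_def by linarith
    then show "x < 2 * pi * of_int (k x) + 2 * pi" by (simp add: pos_divide_less_eq algebra_simps)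
  qed
  have ext: "a x = a\<^sub>0 (x - 2 * pi * of_int j) + A * of_int j"
    if "2 * pi * of_int j \<le> x" "x \<le> 2 * pi * of_int j + 2 * pi + 1" for x and j :: int
  proof (cases "x < 2 * pi * of_int j + 2 * pi")
    case True
    then show ?thesis using kx[of j x] that by (simp add: a_def)
  next
    case False
    have "k x = j + 1" using False that pi_gt3 by (intro kx) (auto simp: algebra_simps)
    then have "a x = a\<^sub>0 (x - 2 * pi * of_int j - 2 * pi) + A * of_int (j + 1)"
      by (simp add: a_def algebra_simps)
    also have "a\<^sub>0 (x - 2 * pi * of_int j - 2 * pi) = a\<^sub>0 0" using False that by (intro left) auto
    also have "a\<^sub>0 0 + A * of_int (j + 1) = a\<^sub>0 (2 * pi) + A * of_int j" by (simp add: A_def algebra_simps)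
    also have "a\<^sub>0 (2 * pi) = a\<^sub>0 (x - 2 * pi * of_int j)" using False that by (intro right[symmetric]) auto
    finally show ?thesis .
  qed
  have per: "a (x + 2 * pi) = a x + A" for x
  proof -
    have "k (x + 2 * pi) = k x + 1" using k[of x] by (intro kx) (auto simp: algebra_simps)
    then show ?thesis by (simp add: a_def algebra_simps)
  qed
  have le: "\<bar>Im (cnj (g (cis x)) * g (cis y)) - (a y - a x)\<bar> \<le> C * (y - x)\<^sup>2" if "x \<le> y" "y \<le> x + 1" for x y
  proof -
    let ?x = "x - 2 * pi * of_int (k x)" and ?y = "y - 2 * pi * of_int (k x)"
    have c: "cis (z - 2 * pi * of_int (k x)) = cis z" for z
      unfolding cis_eq_cis_iff by (rule exI[of _ "- k x"]) simp
    have "\<bar>Im (cnj (g (cis ?x)) * g (cis ?y)) - (a\<^sub>0 ?y - a\<^sub>0 ?x)\<bar> \<le> C * (?y - ?x)\<^sup>2"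
      using k[of x] that by (intro area) auto
    moreover have "a x = a\<^sub>0 ?x + A * of_int (k x)" "a y = a\<^sub>0 ?y + A * of_int (k x)"
      using k[of x] that by (intro ext; linarith)+
    ultimately show ?thesis unfolding c by simp
  qed
  have "\<bar>Im (cnj (g (cis x)) * g (cis y)) - (a y - a x)\<bar> \<le> C * (y - x)\<^sup>2" if "\<bar>y - x\<bar> \<le> 1" for x y
  proof (cases "x \<le> y")
    case True
    then show ?thesis using that by (intro le) auto
  next
    case False
    have "Im (cnj (g (cis x)) * g (cis y)) - (a y - a x) = - (Im (cnj (g (cis y)) * g (cis x)) - (a x - a y))"
      by simp
    then show ?thesis using le[of y x] False that by (simp only: abs_minus_cancel power2_commute[of y x])
  qed
  then show thesis using per that unfolding A_def by blast
qed

text \<open>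
  After the shell map only the bumps up to the \<open>n\<close>-th remain, all with plateau modulus \<open>r\<^sub>n / 2\<close>, so the area
  function is a finite sum of phases times \<open>(r\<^sub>n / 2)\<^sup>2\<close>. The product of the values of two different bumps at
  \<open>x\<close> and \<open>y\<close> is of second order, since each modulus is Lipschitz and vanishes at the other point.
\<close>

lemma swept_area_shell:
  fixes r \<nu> :: "nat \<Rightarrow> real"
  assumes r: "\<And>n. 0 < r n" "\<And>n. r n \<le> half_width n / 2" "\<And>n. r (Suc n) \<le> r n / 2" and \<nu>: "\<And>n. 0 \<le> \<nu> n"
  obtains a A C where "0 \<le> C" "(r n)\<^sup>2 * \<nu> n * half_width n / 4 \<le> A" "\<And>x. a (x + 2 * pi) = a x + A"
    "\<And>x y. \<bar>y - x\<bar> \<le> 1 \<Longrightarrow> \<bar>Im (cnj (shell (r n) (circle_train r \<nu> (cis x))) *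
        shell (r n) (circle_train r \<nu> (cis y))) - (a y - a x)\<bar> \<le> C * (y - x)\<^sup>2"
proof -
  define g where "g = (\<lambda>z. shell (r n) (circle_train r \<nu> z))"
  define \<rho> where "\<rho> = r n / 2"
  define S where "S = (\<lambda>m x. min (amp m (r m) x) (r n) - min (amp m (r m) x) \<rho>)"
  define \<theta> where "\<theta> = (\<lambda>m. phase (centre m) (half_width m / 2) (\<nu> m))"
  define a\<^sub>0 where "a\<^sub>0 = (\<lambda>x. \<Sum>m\<le>n. \<rho>\<^sup>2 * \<theta> m x)"
  define C where "C = (\<Sum>m\<le>n. \<Sum>l\<le>n. if m = l then 2 * 2 * \<rho> * \<nu> m + \<rho>\<^sup>2 * (\<nu> m)\<^sup>2 else 4)"
  have \<rho>: "0 < \<rho>" "r n = 2 * \<rho>" using r(1)[of n] by (auto simp: \<rho>_def)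
  have half: "0 < half_width m" for m by (rule half_width)
  have dec: "r m \<le> r l" if "l \<le> m" for l m
    using that
  proof (induction rule: dec_induct)
    case (step k)
    then show ?case using r(3)[of k] r(1)[of k] by linarith
  qed simp
  have C: "0 \<le> C" unfolding C_def using \<rho> \<nu> by (intro sum_nonneg) auto
  have am: "0 \<le> amp m (r m) x" "amp m (r m) x \<le> r m" for m x
    using r(1)[of m] by (auto intro: amp_bounds less_imp_le)
  have S: "0 \<le> S m x" "S m x \<le> \<rho>" for m x using am[of m x] \<rho> by (auto simp: S_def min_def)
  have SL: "\<bar>S m x - S m y\<bar> \<le> 2 * \<bar>x - y\<bar>" for m x y
  proof -
    have 1: "\<bar>min u c - min v c\<bar> \<le> \<bar>u - v\<bar>" for u v c :: real by (auto simp: min_def)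
    have "S m x - S m y = (min (amp m (r m) x) (r n) - min (amp m (r m) y) (r n)) -
        (min (amp m (r m) x) \<rho> - min (amp m (r m) y) \<rho>)" by (simp add: S_def)
    also have "\<bar>\<dots>\<bar> \<le> \<bar>amp m (r m) x - amp m (r m) y\<bar> + \<bar>amp m (r m) x - amp m (r m) y\<bar>"
      by (intro order_trans[OF abs_triangle_ineq4] add_mono 1)
    also have "\<dots> \<le> 2 * \<bar>x - y\<bar>" using amp_Lipschitz[of m "r m" x y] by simp
    finally show ?thesis .
  qed
  have S0: "S m x = 0" if "x \<notin> window m" for m x using that \<rho> by (simp add: S_def amp_eq_0)
  have Splateau: "S m x = \<rho>" if "m \<le> n" "\<bar>x - centre m\<bar> \<le> half_width m / 2" for m x
  proof -
    have "amp m (r m) x = r m" using that r(1)[of m] r(2)[of m] by (intro amp_plateau) auto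
    then show ?thesis using dec[OF that(1)] \<rho> by (simp add: S_def)
  qed
  have S_small: "S m x = 0" if "n < m" for m x
  proof -
    have "r m \<le> \<rho>" using dec[of "Suc n" m] r(3)[of n] that by (simp add: \<rho>_def)
    then show ?thesis using am[of m x] \<rho> by (simp add: S_def)
  qed
  have g_bump: "g (cis x) = of_real (S m x) * cis (\<theta> m x)" if "x \<in> {0..2*pi+1}" "x \<in> window m" for m x
    using that am[of m x] \<rho> unfolding g_def circle_train_cis[OF that(1)] bump_train_in_window[OF that(2)] bump_def
    by (simp add: shell_polar S_def \<theta>_def)
  have g_sum: "g (cis x) = (\<Sum>m\<le>n. of_real (S m x) * cis (\<theta> m x))" if x: "x \<in> {0..2*pi+1}" for x
  proof (cases "\<exists>k. x \<in> window k")
    case True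
    then obtain k where k: "x \<in> window k" by blast
    have "(\<Sum>m\<le>n. of_real (S m x) * cis (\<theta> m x)) = (\<Sum>m\<le>n. if m = k then of_real (S k x) * cis (\<theta> k x) else 0)"
    proof (intro sum.cong refl)
      fix m
      have "S m x = 0" if "m \<noteq> k" using that S0 window_disjoint[OF k, of m] by blast
      then show "of_real (S m x) * cis (\<theta> m x) = (if m = k then of_real (S k x) * cis (\<theta> k x) else 0)"
        by simp
    qed
    also have "\<dots> = of_real (S k x) * cis (\<theta> k x)" using S_small[of k x] by auto
    finally show ?thesis using g_bump[OF x k] by simp
  next
    case False
    then have "g (cis x) = shell (r n) (of_real 0 * cis 0)"
      by (simp add: g_def circle_train_cis[OF x] bump_train_outside)
    then show ?thesis using False S0 \<rho> by (simp only: shell_polar) (simp add: shell_polar)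
  qed
  have area: "\<bar>Im (cnj (g (cis x)) * g (cis y)) - (a\<^sub>0 y - a\<^sub>0 x)\<bar> \<le> C * (y - x)\<^sup>2"
    if "x \<in> {0..2*pi+1}" "y \<in> {0..2*pi+1}" for x y
  proof -
    let ?t = "\<lambda>m l. S m x * S l y * sin (\<theta> l y - \<theta> m x)"
    have "cnj (g (cis x)) * g (cis y) =
        (\<Sum>m\<le>n. \<Sum>l\<le>n. (of_real (S m x) * cis (- \<theta> m x)) * (of_real (S l y) * cis (\<theta> l y)))"
      unfolding g_sum[OF that(1)] g_sum[OF that(2)] cnj_sum sum_product by (simp add: cis_cnj)
    also have "\<dots> = (\<Sum>m\<le>n. \<Sum>l\<le>n. of_real (S m x * S l y) * cis (\<theta> l y - \<theta> m x))"
    proof (intro sum.cong refl)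
      fix m l
      have "cis (\<theta> l y - \<theta> m x) = cis (- \<theta> m x) * cis (\<theta> l y)" by (simp add: cis_mult)
      then show "(of_real (S m x) * cis (- \<theta> m x)) * (of_real (S l y) * cis (\<theta> l y)) =
          of_real (S m x * S l y) * cis (\<theta> l y - \<theta> m x)" by simp
    qed
    finally have "Im (cnj (g (cis x)) * g (cis y)) = (\<Sum>m\<le>n. \<Sum>l\<le>n. ?t m l)" by simp
    moreover have "a\<^sub>0 y - a\<^sub>0 x = (\<Sum>m\<le>n. \<Sum>l\<le>n. if m = l then \<rho>\<^sup>2 * (\<theta> m y - \<theta> m x) else 0)"
      by (simp add: a\<^sub>0_def algebra_simps sum_subtractf)
    ultimately have "Im (cnj (g (cis x)) * g (cis y)) - (a\<^sub>0 y - a\<^sub>0 x) =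
        (\<Sum>m\<le>n. \<Sum>l\<le>n. ?t m l - (if m = l then \<rho>\<^sup>2 * (\<theta> m y - \<theta> m x) else 0))"
      by (simp add: sum_subtractf)
    then have "\<bar>Im (cnj (g (cis x)) * g (cis y)) - (a\<^sub>0 y - a\<^sub>0 x)\<bar> =
        \<bar>\<Sum>m\<le>n. \<Sum>l\<le>n. ?t m l - (if m = l then \<rho>\<^sup>2 * (\<theta> m y - \<theta> m x) else 0)\<bar>"
      by (rule arg_cong)
    also have "\<dots> \<le> (\<Sum>m\<le>n. \<Sum>l\<le>n. \<bar>?t m l - (if m = l then \<rho>\<^sup>2 * (\<theta> m y - \<theta> m x) else 0)\<bar>)"
      by (intro order_trans[OF sum_abs] sum_mono order_refl)
    also have "\<dots> \<le> (\<Sum>m\<le>n. \<Sum>l\<le>n. (if m = l then 2 * 2 * \<rho> * \<nu> m + \<rho>\<^sup>2 * (\<nu> m)\<^sup>2 else 4) * (y - x)\<^sup>2)"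
    proof (intro sum_mono)
      fix m l assume ml: "m \<in> {..n}" "l \<in> {..n}"
      show "\<bar>?t m l - (if m = l then \<rho>\<^sup>2 * (\<theta> m y - \<theta> m x) else 0)\<bar>
        \<le> (if m = l then 2 * 2 * \<rho> * \<nu> m + \<rho>\<^sup>2 * (\<nu> m)\<^sup>2 else 4) * (y - x)\<^sup>2"
      proof (cases "m = l")
        case True
        have "\<bar>S m x * S m y * sin (\<theta> m y - \<theta> m x) - \<rho>\<^sup>2 * (\<theta> m y - \<theta> m x)\<bar>
            \<le> (2 * 2 * \<rho> * \<nu> m + \<rho>\<^sup>2 * (\<nu> m)\<^sup>2) * (y - x)\<^sup>2"
          unfolding \<theta>_def
          by (rule spinning_area) (use half[of m] \<nu> SL S Splateau ml in auto)
        then show ?thesis using True by simp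
      next
        case False
        have "S m x * S l y \<le> 4 * (y - x)\<^sup>2"
        proof (cases "x \<in> window m \<and> y \<in> window l")
          case True
          then have "S m y = 0" "S l x = 0" using False window_disjoint S0 by blast+
          then have "S m x \<le> 2 * \<bar>y - x\<bar>" "S l y \<le> 2 * \<bar>y - x\<bar>"
            using SL[of m x y] SL[of l y x] abs_ge_self[of "S m x"] abs_ge_self[of "S l y"]
            by (simp_all add: abs_minus_commute[of x y])
          then have "S m x * S l y \<le> (2 * \<bar>y - x\<bar>) * (2 * \<bar>y - x\<bar>)" using S by (intro mult_mono) auto
          then show ?thesis by (simp add: power2_eq_square flip: abs_mult)
        next
          case False
          then have z: "S m x * S l y = 0" using S0 by auto
          show ?thesis unfolding z by simp
        qed
        moreover have "\<bar>?t m l\<bar> \<le> S m x * S l y"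
          using S by (simp add: abs_mult mult_left_le)
        ultimately show ?thesis using False by simp
      qed
    qed
    also have "\<dots> = C * (y - x)\<^sup>2" unfolding C_def sum_distrib_right by simp
    finally show ?thesis .
  qed
  have before: "\<theta> m x = - (\<nu> m * (half_width m / 2))" if "x \<le> 1" for m x
    unfolding \<theta>_def using that half_width[of m] by (intro phase_before) (simp_all add: centre_def)
  have after: "\<theta> m x = \<nu> m * (half_width m / 2)" if "2 \<le> x" for m x
    unfolding \<theta>_def using that half_width[of m] by (intro phase_after) (simp_all add: centre_def)
  have "a\<^sub>0 x = a\<^sub>0 0" if "x \<in> {0..1}" for x
    using that by (simp add: a\<^sub>0_def before)
  moreover have "a\<^sub>0 x = a\<^sub>0 (2 * pi)" if "x \<in> {2*pi..2*pi+1}" for x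
    using that pi_gt3 by (simp add: a\<^sub>0_def after)
  ultimately obtain a where a: "\<And>x. a (x + 2 * pi) = a x + (a\<^sub>0 (2 * pi) - a\<^sub>0 0)"
    "\<And>x y. \<bar>y - x\<bar> \<le> 1 \<Longrightarrow> \<bar>Im (cnj (g (cis x)) * g (cis y)) - (a y - a x)\<bar> \<le> C * (y - x)\<^sup>2"
    using periodic_swept_area[OF area] by blast
  have "\<rho>\<^sup>2 * (\<nu> n * half_width n) \<le> (\<Sum>m\<le>n. \<rho>\<^sup>2 * (\<nu> m * half_width m))"
    using half \<nu> by (intro member_le_sum) (auto simp: less_imp_le)
  also have "\<dots> = a\<^sub>0 (2 * pi) - a\<^sub>0 0"
    using pi_gt3 unfolding a\<^sub>0_def sum_subtractf[symmetric] by (simp add: before after algebra_simps)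
  finally have "(r n)\<^sup>2 * \<nu> n * half_width n / 4 \<le> a\<^sub>0 (2 * pi) - a\<^sub>0 0"
    by (simp add: \<rho>_def power2_eq_square algebra_simps)
  then show thesis
    using C a unfolding g_def by (intro that[where a=a and A="a\<^sub>0 (2 * pi) - a\<^sub>0 0" and C=C])
qed

section \<open>Moduli of continuity\<close>

lemma modulus_scale_le:
  assumes \<omega>: "modulus_of_continuity \<omega>" and "0 \<le> h" "0 < x"
  shows "\<omega> h \<le> (h / x + 1) * \<omega> x"
proof -
  from \<omega> have mono: "\<And>u v. 0 \<le> u \<Longrightarrow> u \<le> v \<Longrightarrow> \<omega> u \<le> \<omega> v" and sub: "\<And>u v. 0 \<le> u \<Longrightarrow> 0 \<le> v \<Longrightarrow> \<omega> (u + v) \<le> \<omega> u + \<omega> v"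
    and zero: "\<omega> 0 = 0"
    by (auto simp: modulus_of_continuity_def mono_on_def)
  have mult: "\<omega> (real n * x) \<le> real n * \<omega> x" for n
  proof (induction n)
    case (Suc n)
    have "\<omega> (real n * x + x) \<le> \<omega> (real n * x) + \<omega> x" using \<open>0 < x\<close> by (intro sub) auto
    with Suc show ?case by (simp add: algebra_simps)
  qed (simp add: zero)
  define n where "n = nat \<lceil>h / x\<rceil>"
  have n: "h / x \<le> real n" "real n \<le> h / x + 1"
  proof -
    have "0 \<le> h / x" using assms by simp
    then show "h / x \<le> real n" "real n \<le> h / x + 1" unfolding n_def by linarith+
  qed
  have "\<omega> h \<le> \<omega> (real n * x)" using n(1) assms by (intro mono) (auto simp: field_simps)
  also have "\<dots> \<le> real n * \<omega> x" by (rule mult)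
  also have "\<dots> \<le> (h / x + 1) * \<omega> x" using n(2) mono[of 0 x] zero assms by (intro mult_right_mono) auto
  finally show ?thesis .
qed

text \<open>
  The pair (radius \<open>\<omega> h\<close>, speed \<open>1 / h\<close>) is compatible with \<open>\<omega>\<close>: below the scale \<open>h\<close> the arc length
  \<open>\<delta> \<omega> h / h\<close> is at most \<open>2 \<omega> \<delta>\<close> by subadditivity, above it the diameter \<open>2 \<omega> h\<close> is at most \<open>2 \<omega> \<delta>\<close>.
  Subadditivity also gives the linear lower bound on \<open>\<omega>\<close> that absorbs the radial motion.
\<close>

lemma modulus_bump_le:
  assumes \<omega>: "modulus_of_continuity \<omega>" and "0 < \<omega> 1" and h: "0 < h" and \<delta>: "0 \<le> \<delta>" "\<delta> \<le> 1"
  shows "\<delta> + \<omega> h * min 2 (1 / h * \<delta>) \<le> (2 / \<omega> 1 + 2) * \<omega> \<delta>"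
proof (cases "\<delta> = 0")
  case True
  then show ?thesis using \<omega> by (simp add: modulus_of_continuity_def)
next
  case False
  with \<delta> have d: "0 < \<delta>" by simp
  from \<omega> have mono: "\<And>u v. 0 \<le> u \<Longrightarrow> u \<le> v \<Longrightarrow> \<omega> u \<le> \<omega> v" and zero: "\<omega> 0 = 0"
    by (auto simp: modulus_of_continuity_def mono_on_def)
  have pos: "0 \<le> \<omega> \<delta>" "0 \<le> \<omega> h" using mono[of 0 \<delta>] mono[of 0 h] zero d h by auto
  have scale: "\<delta> * \<omega> u \<le> 2 * u * \<omega> \<delta>" if "\<delta> \<le> u" for u
  proof -
    have "\<delta> * \<omega> u \<le> \<delta> * ((u / \<delta> + 1) * \<omega> \<delta>)"
      using modulus_scale_le[OF \<omega> _ d, of u] that d by (intro mult_left_mono) auto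
    also have "\<dots> = (u + \<delta>) * \<omega> \<delta>" using d by (simp add: field_simps)
    also have "\<dots> \<le> 2 * u * \<omega> \<delta>" using that pos by (intro mult_right_mono) auto
    finally show ?thesis .
  qed
  have "\<delta> \<le> 2 / \<omega> 1 * \<omega> \<delta>" using scale[of 1] \<delta> \<open>0 < \<omega> 1\<close> by (simp add: field_simps)
  moreover have "\<omega> h * min 2 (1 / h * \<delta>) \<le> 2 * \<omega> \<delta>"
  proof (cases "\<delta> \<le> h")
    case True
    have "\<omega> h * min 2 (1 / h * \<delta>) \<le> \<omega> h * (1 / h * \<delta>)" using pos by (intro mult_left_mono) auto
    also have "\<dots> \<le> 2 * \<omega> \<delta>" using scale[OF True] h by (simp add: field_simps)
    finally show ?thesis .
  next
    case False
    have "\<omega> h * min 2 (1 / h * \<delta>) \<le> \<omega> h * 2" using pos by (intro mult_left_mono) auto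
    also have "\<dots> \<le> 2 * \<omega> \<delta>" using mono[of h \<delta>] False h by simp
    finally show ?thesis .
  qed
  ultimately show ?thesis by (simp add: distrib_right)
qed

lemma steep_scales:
  assumes \<omega>: "modulus_of_continuity \<omega>" and lim: "Limsup (at_right 0) (\<lambda>\<delta>. ereal (\<omega> \<delta> / sqrt \<delta>)) = \<infinity>"
    and "0 < \<epsilon>"
  obtains h where "0 < h" "h < 1" "0 < \<omega> h" "\<omega> h \<le> \<epsilon>" "K \<le> (\<omega> h)\<^sup>2 / h"
proof -
  have c0: "continuous_on {0..} \<omega>" and zero: "\<omega> 0 = 0" using \<omega> by (auto simp: modulus_of_continuity_def)
  have "(\<omega> \<longlongrightarrow> \<omega> 0) (at 0 within {0..})" using c0 by (auto simp: continuous_on_def)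
  then have "(\<omega> \<longlongrightarrow> 0) (at_right 0)" unfolding zero by (rule tendsto_within_subset) auto
  then have e1: "\<forall>\<^sub>F h in at_right 0. \<omega> h < \<epsilon>" using \<open>0 < \<epsilon>\<close> by (rule order_tendstoD)
  have e2: "\<forall>\<^sub>F h in at_right 0. 0 < h \<and> h < (1::real)"
    by (auto simp: eventually_at_right_field intro: exI[of _ 1])
  have "\<exists>\<^sub>F h in at_right 0. \<bar>K\<bar> + 1 < \<omega> h / sqrt h"
  proof (rule ccontr)
    assume "\<not> ?thesis"
    then have "\<forall>\<^sub>F h in at_right 0. \<omega> h / sqrt h \<le> \<bar>K\<bar> + 1" by (simp add: not_frequently not_less)
    then have "\<forall>\<^sub>F h in at_right 0. ereal (\<omega> h / sqrt h) \<le> ereal (\<bar>K\<bar> + 1)" by simp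
    then have "Limsup (at_right 0) (\<lambda>\<delta>. ereal (\<omega> \<delta> / sqrt \<delta>)) \<le> ereal (\<bar>K\<bar> + 1)" by (rule Limsup_bounded)
    then show False using lim by simp
  qed
  then have "\<exists>\<^sub>F h in at_right 0. (\<omega> h < \<epsilon> \<and> 0 < h \<and> h < 1) \<and> \<bar>K\<bar> + 1 < \<omega> h / sqrt h"
    using eventually_conj[OF e1 e2] by (rule frequently_eventually_conj)
  then obtain h where h: "\<bar>K\<bar> + 1 < \<omega> h / sqrt h" "\<omega> h < \<epsilon>" "0 < h" "h < 1"
    using frequently_ex by blast
  have q: "0 < \<omega> h / sqrt h" using h(1) by linarith
  then have "0 < \<omega> h" using h(3) by (simp add: zero_less_divide_iff)
  moreover have "K \<le> (\<omega> h)\<^sup>2 / h"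
  proof -
    have "K \<le> (\<bar>K\<bar> + 1) * 1" by simp
    also have "\<dots> \<le> (\<omega> h / sqrt h) * (\<omega> h / sqrt h)" using h(1) by (intro mult_mono) auto
    also have "\<dots> = (\<omega> h)\<^sup>2 / h" using h(3) by (simp add: power2_eq_square)
    finally show ?thesis .
  qed
  ultimately show thesis using that h by auto
qed

lemma modulus_of_continuity_powr:
  assumes "0 < \<alpha>" "\<alpha> \<le> 1"
  shows "modulus_of_continuity (\<lambda>\<delta>. \<delta> powr \<alpha>)"
  unfolding modulus_of_continuity_def
proof (intro conjI allI impI)
  show "mono_on {0..} (\<lambda>\<delta>. \<delta> powr \<alpha>)" using assms by (auto simp: mono_on_def intro: powr_mono2)
  show "continuous_on {0..} (\<lambda>\<delta>. \<delta> powr \<alpha>)" using assms by (intro continuous_on_powr' continuous_intros) auto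
  fix x y :: real assume xy: "x \<ge> 0" "y \<ge> 0"
  show "(x + y) powr \<alpha> \<le> x powr \<alpha> + y powr \<alpha>"
  proof (cases "x + y = 0")
    case False
    define z where "z = x + y"
    have z: "0 < z" using False xy by (simp add: z_def)
    have part: "u / z * z powr \<alpha> \<le> u powr \<alpha>" if "0 \<le> u" "u \<le> z" for u
    proof -
      have "u / z \<le> (u / z) powr \<alpha>"
        using powr_mono'[of \<alpha> 1 "u / z"] that z assms by simp
      then have "u / z * z powr \<alpha> \<le> (u / z) powr \<alpha> * z powr \<alpha>" by (intro mult_right_mono) auto
      also have "\<dots> = u powr \<alpha>" using that z by (simp flip: powr_mult)
      finally show ?thesis .
    qed
    have "(x + y) powr \<alpha> = x / z * z powr \<alpha> + y / z * z powr \<alpha>"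
      using z by (simp add: z_def flip: distrib_right add_divide_distrib)
    also have "\<dots> \<le> x powr \<alpha> + y powr \<alpha>" using xy by (intro add_mono part) (auto simp: z_def)
    finally show ?thesis .
  qed simp
qed simp

lemma Limsup_powr_div_sqrt:
  assumes "\<alpha> < 1 / 2"
  shows "Limsup (at_right 0) (\<lambda>\<delta>. ereal (\<delta> powr \<alpha> / sqrt \<delta>)) = \<infinity>"
proof (rule lim_imp_Limsup)
  have "((\<lambda>\<delta>::real. \<delta> powr (1 / 2 - \<alpha>)) \<longlongrightarrow> 0 powr (1 / 2 - \<alpha>)) (at_right 0)"
    using assms eventually_at_right_less[of "0::real"]
    by (intro tendsto_powr' tendsto_ident_at tendsto_const) (auto elim: eventually_mono)
  moreover have pos: "\<forall>\<^sub>F \<delta> in at_right (0::real). 0 < \<delta> powr (1 / 2 - \<alpha>)"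
    using eventually_at_right_less[of "0::real"] by eventually_elim simp
  ultimately have "filterlim (\<lambda>\<delta>::real. inverse (\<delta> powr (1 / 2 - \<alpha>))) at_top (at_right 0)"
    by (intro filterlim_inverse_at_top) simp_all
  moreover have "\<forall>\<^sub>F \<delta> in at_right (0::real). inverse (\<delta> powr (1 / 2 - \<alpha>)) = \<delta> powr \<alpha> / sqrt \<delta>"
    using eventually_at_right_less[of "0::real"] by eventually_elim (simp add: powr_diff powr_half_sqrt)
  ultimately have "filterlim (\<lambda>\<delta>::real. \<delta> powr \<alpha> / sqrt \<delta>) at_top (at_right 0)"
    by (rule filterlim_mono_eventually[OF _ order_refl order_refl])
  then show "((\<lambda>\<delta>. ereal (\<delta> powr \<alpha> / sqrt \<delta>)) \<longlongrightarrow> \<infinity>) (at_right 0)"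
    by (simp add: tendsto_PInfty_eq_at_top)
qed simp

section \<open>Loops that no homeomorphism brings into the Sobolev space\<close>

lemma W_half_imp_sobolev_sum_bounded:
  assumes "F \<in> W_half" and c: "continuous_on circle F"
  obtains E where "\<And>M. sobolev_sum (\<lambda>t. F (cis t)) M \<le> E"
proof
  fix M
  have "(\<lambda>k::int. (cmod (fourier_coeff F k))\<^sup>2 * real_of_int \<bar>k\<bar>) summable_on UNIV"
    using assms(1) by (simp add: W_half_def)
  then have "(\<Sum>k\<in>{- int M..int M}. (cmod (fourier_coeff F k))\<^sup>2 * real_of_int \<bar>k\<bar>)
      \<le> (\<Sum>\<^sub>\<infinity>k. (cmod (fourier_coeff F k))\<^sup>2 * real_of_int \<bar>k\<bar>)"
    by (rule finite_sum_le_infsum) auto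
  then show "sobolev_sum (\<lambda>t. F (cis t)) M \<le> (\<Sum>\<^sub>\<infinity>k. (cmod (fourier_coeff F k))\<^sup>2 * real_of_int \<bar>k\<bar>)"
    by (simp add: sobolev_sum_def fourier_coeff_eq_coef continuous_on_cis_compose c mult.commute)
qed

text \<open>
  The scales \<open>s n\<close> are chosen one after the other, so that the radii halve at least and
  \<open>half_width n * (r n)\<^sup>2 / s n\<close>, which bounds the area in the \<open>n\<close>-th shell from below up to a factor, is at least \<open>n\<close>.
\<close>

lemma exists_not_W_half:
  assumes \<omega>: "modulus_of_continuity \<omega>" and lim: "Limsup (at_right 0) (\<lambda>\<delta>. ereal (\<omega> \<delta> / sqrt \<delta>)) = \<infinity>"
  shows "\<exists>f \<in> Lip \<omega>. \<forall>h g. homeomorphism circle circle h g \<longrightarrow> f \<circ> h \<notin> W_half"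
proof -
  from \<omega> have mono: "\<And>u v. 0 \<le> u \<Longrightarrow> u \<le> v \<Longrightarrow> \<omega> u \<le> \<omega> v" and zero: "\<omega> 0 = 0"
    by (auto simp: modulus_of_continuity_def mono_on_def)
  define P where "P = (\<lambda>n s. 0 < s \<and> s < 1 \<and> 0 < \<omega> s \<and> \<omega> s \<le> half_width n / 2 \<and>
     real n / half_width n \<le> (\<omega> s)\<^sup>2 / s)"
  have "\<exists>s. \<forall>n. P n (s n) \<and> \<omega> (s (Suc n)) \<le> \<omega> (s n) / 2"
  proof (rule dependent_nat_choice)
    show "\<exists>s. P 0 s" unfolding P_def using half_width[of 0] steep_scales[OF \<omega> lim, of "half_width 0 / 2"]
      by (metis half_gt_zero)
    fix s n assume "P n s"
    then have "0 < min (half_width (Suc n) / 2) (\<omega> s / 2)" using half_width[of "Suc n"] by (auto simp: P_def)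
    from steep_scales[OF \<omega> lim this, of "real (Suc n) / half_width (Suc n)"]
    show "\<exists>s'. P (Suc n) s' \<and> \<omega> s' \<le> \<omega> s / 2"
      unfolding P_def by (metis min.bounded_iff)
  qed
  then obtain s where s: "\<And>n. P n (s n)" "\<And>n. \<omega> (s (Suc n)) \<le> \<omega> (s n) / 2" by blast
  define r where "r = (\<lambda>n. \<omega> (s n))"
  define \<nu> where "\<nu> = (\<lambda>n. 1 / s n)"
  define f where "f = circle_train r \<nu>"
  have r: "0 < r n" "r n \<le> half_width n / 2" "r (Suc n) \<le> r n / 2" and \<nu>: "0 \<le> \<nu> n" and s0: "0 < s n"
    and big: "real n / half_width n \<le> (r n)\<^sup>2 / s n" for n
    using s(1)[of n] s(2)[of n] by (auto simp: P_def r_def \<nu>_def)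
  have \<omega>1: "0 < \<omega> 1" using s(1)[of 0] mono[of "s 0" 1] by (auto simp: P_def)
  define b where "b = (\<lambda>\<delta>. (2 / \<omega> 1 + 2) * \<omega> \<delta>)"
  have bump: "cmod (bump n (r n) (\<nu> n) x - bump n (r n) (\<nu> n) y) \<le> b \<bar>x - y\<bar>" if "\<bar>x - y\<bar> \<le> 1" for n x y
  proof -
    have "cmod (bump n (r n) (\<nu> n) x - bump n (r n) (\<nu> n) y) \<le> \<bar>x - y\<bar> + r n * min 2 (\<nu> n * \<bar>x - y\<bar>)"
      using r(1)[of n] \<nu> by (intro bump_diff_le) auto
    also have "\<dots> \<le> b \<bar>x - y\<bar>"
      unfolding r_def \<nu>_def b_def using that s0 by (intro modulus_bump_le \<omega> \<omega>1) auto
    finally show ?thesis .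
  qed
  have fb: "cmod (f (cis x) - f (cis y)) \<le> 2 * b \<bar>x - y\<bar>" if "\<bar>x - y\<bar> \<le> 1" for x y
    unfolding f_def by (rule circle_train_diff_le[OF bump that])
  have "f \<in> Lip \<omega>"
  proof -
    define K where "K = 2 * (2 / \<omega> 1 + 2)"
    have "modcont f \<delta> \<le> ereal (K * \<bar>\<omega> \<delta>\<bar>)" if \<delta>: "0 < \<delta>" "\<delta> < 1" for \<delta>
      unfolding modcont_def
    proof (rule SUP_least, clarify)
      fix x y :: real assume xy: "\<bar>x - y\<bar> \<le> \<delta>"
      have "cmod (f (cis x) - f (cis y)) \<le> K * \<omega> \<bar>x - y\<bar>"
        using fb[of x y] xy \<delta> unfolding b_def K_def mult.assoc by linarith
      also have "\<dots> \<le> K * \<bar>\<omega> \<delta>\<bar>"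
        using mono[OF _ xy] \<omega>1 by (intro mult_left_mono) (auto simp: K_def)
      finally show "ereal (cmod (f (cis x) - f (cis y))) \<le> ereal (K * \<bar>\<omega> \<delta>\<bar>)" by simp
    qed
    moreover have "\<forall>\<^sub>F \<delta> in at_right 0. 0 < \<delta> \<and> \<delta> < (1::real)"
      by (auto simp: eventually_at_right_field intro: exI[of _ 1])
    ultimately have "\<forall>\<^sub>F \<delta> in at_right 0. modcont f \<delta> \<le> ereal (K * \<bar>\<omega> \<delta>\<bar>)"
      by (auto elim: eventually_mono)
    moreover have "K > 0" using \<omega>1 by (simp add: K_def add_pos_pos)
    ultimately show ?thesis unfolding Lip_def by blast
  qed
  moreover have "f \<circ> h \<notin> W_half" if hom: "homeomorphism circle circle h g" for h g
  proof
    assume W: "f \<circ> h \<in> W_half"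
    have h: "continuous_on circle h" "inj_on h circle" "h ` circle \<subseteq> circle"
      using hom by (auto simp: homeomorphism_def intro: inj_on_inverseI)
    have cf: "continuous_on circle f"
    proof (rule continuous_on_circleI, rule continuous_at_imp_continuous_on, rule ballI)
      fix x
      have "continuous_on {0..} \<omega>" using \<omega> by (simp add: modulus_of_continuity_def)
      then have "continuous_on UNIV (\<lambda>y. \<omega> \<bar>y - x\<bar>)"
        by (rule continuous_on_compose2) (auto intro!: continuous_on_rabs continuous_on_diff continuous_on_id continuous_on_const)
      then have "continuous_on UNIV (\<lambda>y. 2 * b \<bar>y - x\<bar>)"
        unfolding b_def by (intro continuous_on_mult continuous_on_const)
      then have "((\<lambda>y. 2 * b \<bar>y - x\<bar>) \<longlongrightarrow> 2 * b \<bar>x - x\<bar>) (at x)"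
        unfolding continuous_on_def by blast
      then have "((\<lambda>y. 2 * b \<bar>y - x\<bar>) \<longlongrightarrow> 0) (at x)" by (simp add: b_def zero)
      then have "((\<lambda>y. f (cis y) - f (cis x)) \<longlongrightarrow> 0) (at x)"
      proof (rule Lim_null_comparison[rotated])
        have "\<forall>\<^sub>F y in at x. dist y x < 1" by (auto simp: eventually_at intro: exI[of _ 1])
        then show "\<forall>\<^sub>F y in at x. norm (f (cis y) - f (cis x)) \<le> 2 * b \<bar>y - x\<bar>"
          by eventually_elim (simp add: fb dist_real_def)
      qed
      then show "isCont (\<lambda>t. f (cis t)) x" unfolding isCont_def by (rule LIM_zero_cancel)
    qed
    have cfh: "continuous_on circle (f \<circ> h)"
      using continuous_on_compose2[OF cf h(1) h(3)] by (simp add: o_def)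
    obtain E where E: "\<And>M. sobolev_sum (\<lambda>t. (f \<circ> h) (cis t)) M \<le> E"
      using W_half_imp_sobolev_sum_bounded[OF W cfh] by blast
    have "real n \<le> 32 * pi * E" for n
    proof -
      let ?g = "\<lambda>z. shell (r n) (f z)"
      have r0: "0 \<le> r n" using r(1)[of n] by simp
      obtain a A C where C: "0 \<le> C" and A: "(r n)\<^sup>2 * \<nu> n * half_width n / 4 \<le> A"
        and a: "\<And>x. a (x + 2 * pi) = a x + A"
        "\<And>x y. \<bar>y - x\<bar> \<le> 1 \<Longrightarrow> \<bar>Im (cnj (?g (cis x)) * ?g (cis y)) - (a y - a x)\<bar> \<le> C * (y - x)\<^sup>2"
        using swept_area_shell[of r \<nu> n, OF r \<nu>] unfolding f_def by metis
      have cg: "continuous_on circle ?g"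
        by (rule continuous_on_compose2[OF continuous_on_shell[OF r0, of UNIV] cf]) simp
      have cgh: "continuous_on UNIV (\<lambda>t. ?g (h (cis t)))"
        using continuous_on_cis_compose[OF continuous_on_compose2[OF cg h(1) h(3)]] .
      have "sobolev_sum (\<lambda>t. ?g (h (cis t))) M \<le> 2\<^sup>2 * E" for M
        by (rule sobolev_sum_Lipschitz[OF cfh cgh E]) (simp add: shell_Lipschitz[OF r0])
      then have "A \<le> 2 * pi * (2\<^sup>2 * E)"
        using swept_area_le_sobolev_sum[OF cg h _ a(1) C a(2)] by blast
      moreover have "real n / 4 \<le> A"
        using A big[of n] half_width[of n] by (simp add: \<nu>_def field_simps)
      ultimately show ?thesis by simp
    qed
    then show False using reals_Archimedean2[of "32 * pi * E"] by (meson not_le)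
  qed
  ultimately show ?thesis by blast
qed

theorem mainTheorem1:
  "(\<forall>\<omega>::real \<Rightarrow> real.
      modulus_of_continuity \<omega> \<and> Limsup (at_right 0) (\<lambda>\<delta>. ereal (\<omega> \<delta> / sqrt \<delta>)) = \<infinity> \<longrightarrow>
      (\<exists>f \<in> Lip \<omega>. \<forall>h g. homeomorphism circle circle h g \<longrightarrow> f \<circ> h \<notin> W_half)) \<and>
   (\<forall>\<alpha>::real. 0 < \<alpha> \<and> \<alpha> < 1 / 2 \<longrightarrow>
      (\<exists>f \<in> Lip (\<lambda>\<delta>. \<delta> powr \<alpha>). \<forall>h g. homeomorphism circle circle h g \<longrightarrow> f \<circ> h \<notin> W_half))"
proof (intro conjI allI impI)
  fix \<omega> :: "real \<Rightarrow> real"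
  assume "modulus_of_continuity \<omega> \<and> Limsup (at_right 0) (\<lambda>\<delta>. ereal (\<omega> \<delta> / sqrt \<delta>)) = \<infinity>"
  then show "\<exists>f \<in> Lip \<omega>. \<forall>h g. homeomorphism circle circle h g \<longrightarrow> f \<circ> h \<notin> W_half"
    using exists_not_W_half by blast
next
  fix \<alpha> :: real
  assume "0 < \<alpha> \<and> \<alpha> < 1 / 2"
  then show "\<exists>f \<in> Lip (\<lambda>\<delta>. \<delta> powr \<alpha>). \<forall>h g. homeomorphism circle circle h g \<longrightarrow> f \<circ> h \<notin> W_half"
    by (intro exists_not_W_half modulus_of_continuity_powr Limsup_powr_div_sqrt) auto
qed

end
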